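(* Let $A,B$ be RSLR types and let $\mathcal T,\mathcal S$ be term distributions over closed terms of type $A$ with $\delta^{\mathtt T}(\mathcal T,\mathcal S)=d$. Then for every context $C$ with $\vdash C[\vdash A]:B$, $\delta^{\mathtt T}(C[\mathcal T],C[\mathcal S])\le d$.
   Context: \textbf{The calculus RSLR.} Aspects are $\square$ and $\blacksquare$, ordered by $\square<:\square$, $\square<:\blacksquare$, $\blacksquare<:\blacksquare$. Types: $A::=\mathsf{Str}\mid\mathsf aA\to A$. Subtyping: least reflexive transitive relation with $\mathsf aA\to C<:\mathsf bB\to D$ whenever $B<:A$, $C<:D$, $\mathsf a<:\mathsf b$. Terms: $t::=x\mid\underline m\mid\lambda x:\mathsf aA.t\mid\mathsf0(t)\mid\mathsf1(t)\mid\mathsf{tail}(t)\mid t\,t\mid\mathsf{case}_A(t,t_0,t_1,t_\epsilon)\mid\mathsf{rec}_A(t,t_0,t_1,t_\epsilon)\mid\mathsf{rand}$ with $m\in\{0,1\}^*$; values are string constants and abstractions. Typing contexts are finite sets of declarations $x:\mathsf aA$; $\Gamma;\Delta$ denotes disjoint union where $\Gamma$ declares only $\mathsf{Str}$ variables; $\Gamma<:\mathsf a$ means all declared aspects $\mathsf b$ satisfy $\mathsf b<:\mathsf a$. Typing rules: variables, string constants of type $\mathsf{Str}$, $\mathsf0,\mathsf1,\mathsf{tail}$ from $\mathsf{Str}$ to $\mathsf{Str}$, $\vdash\mathsf{rand}:\mathsf{Str}$, abstraction, subsumption; application: $\Gamma;\Delta_1\vdash t:\mathsf aA\to B$, $\Gamma;\Delta_2\vdash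 s:A$, $\Gamma,\Delta_2<:\mathsf a$ give $\Gamma;\Delta_1,\Delta_2\vdash ts:B$; case: $\Gamma;\Delta_1\vdash t:\mathsf{Str}$, $\Gamma;\Delta_2\vdash t_0:A$, $\Gamma;\Delta_3\vdash t_1:A$, $\Gamma;\Delta_4\vdash t_\epsilon:A$ give $\Gamma;\Delta_1,\dots,\Delta_4\vdash\mathsf{case}_A(t,t_0,t_1,t_\epsilon):A$; recursion: $\Gamma_1;\Delta_1\vdash t:\mathsf{Str}$, $\Gamma_1,\Gamma_2\vdash t_0:\square\mathsf{Str}\to\blacksquare A\to A$, $\Gamma_1,\Gamma_3\vdash t_1:\square\mathsf{Str}\to\blacksquare A\to A$, $\Gamma_1,\Gamma_2,\Gamma_3;\Delta_2\vdash t_\epsilon:A$, $\Gamma_1,\Delta_1<:\square$, $A$ $\square$-free give $\Gamma_1,\Gamma_2,\Gamma_3;\Delta_1,\Delta_2\vdash\mathsf{rec}_A(t,t_0,t_1,t_\epsilon):A$. Every closed typable $t$ has a value distribution $[\![t]\!]$ given by probabilistic call-by-value big-step semantics: values evaluate to themselves; $\mathsf{rand}$ yields $\underline0,\underline1$ with probability $1/2$ each; $\mathsf0,\mathsf1$ prepend a bit, $\mathsf{tail}$ drops the first bit ($\mathrm{tail}(\epsilon)=\epsilon$); $[\![ts]\!]=\sum[\![t]\!](\lambda x.r)[\![s]\!](v)[\![r\{v/x\}]\!]$; $\mathsf{case}$ continues with $t_0$, $t_1$ or $t_\epsilon$ according to whether the evaluated string begins with $0$, with $1$, or is empty; $\mathsf{rec}_A(\underline\epsilon,\dots)$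 continues as $t_\epsilon$, $\mathsf{rec}_A(\underline{bn},t_0,t_1,t_\epsilon)$ as $(t_b\,\underline{bn})(\mathsf{rec}_A(\underline n,t_0,t_1,t_\epsilon))$. \textbf{Contexts.} Generated by $C::=t\mid[\cdot]\mid\lambda x.C\mid C\,t\mid t\,C\mid\mathsf0(C)\mid\mathsf1(C)\mid\mathsf{tail}(C)\mid\mathsf{case}_A(C,t,t,t)\mid\mathsf{case}_A(t,C,C,C)\mid\mathsf{rec}_A(C,t,t,t)$, hole occurring at most once; $C[t]$ fills the hole with the closed term $t$; $\vdash C[\vdash A]:B$ means that for every closed $t$ with $\vdash t:A$, $\vdash C[t]:B$. \textbf{Term distributions and trace distance.} A term distribution of type $A$ is a probability distribution $\mathcal T$ on closed terms of type $A$; $C[\mathcal T]$ is the distribution assigning to each term $u$ the probability $\sum_{t:\,C[t]=u}\mathcal T(t)$. Actions are $\mathsf{pass}(v)$ ($v$ closed value) and $\mathsf{view}(M)$ ($M$ a finite set of strings). Traces compatible with $\mathsf{Str}$: $\mathsf{view}(M)$; with $\mathsf bB\to C$: $\mathsf{pass}(v)\cdot S$ with $\vdash v:B$ and $S$ compatible with $C$. For $\mathcal T$ of type $\mathsf a_1A_1\to\cdots\to\mathsf a_kA_k\to\mathsf{Str}$ and $T=\mathsf{pass}(v_1)\cdots\mathsf{pass}(v_k)\mathsf{view}(M)$, let $\mathcal D_0=\sum_t\mathcal T(t)[\![t]\!]$, $\mathcal D_i=\sum_{\lambda x.r}\mathcal D_{i-1}(\lambda x.r)[\![r\{v_i/x\}]\!]$,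 and $\Pr(\mathcal T,T)=\sum_{m\in M}\mathcal D_k(\underline m)$. The trace distance is $\delta^{\mathtt T}(\mathcal T,\mathcal S)=\sup_T|\Pr(\mathcal T,T)-\Pr(\mathcal S,T)|$, the supremum over traces compatible with the type. *)

theory Defs
  imports "HOL-Probability.SPMF"
begin

section \<open>Types and subtyping\<close>

datatype aspect = Box | Black

fun asp_le :: "aspect \<Rightarrow> aspect \<Rightarrow> bool" where
  "asp_le Box b = True"
| "asp_le Black b = (b = Black)"

datatype ty = TStr | Arr aspect ty ty

inductive subtype :: "ty \<Rightarrow> ty \<Rightarrow> bool" where
  sub_refl: "subtype A A"
| sub_trans: "subtype A B \<Longrightarrow> subtype B C \<Longrightarrow> subtype A C"
| sub_arr: "subtype B A \<Longrightarrow> subtype C D \<Longrightarrow> asp_le a b \<Longrightarrow> subtype (Arr a A C) (Arr b B D)"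

fun box_free :: "ty \<Rightarrow> bool" where
  "box_free TStr = True"
| "box_free (Arr a A B) = (a = Black \<and> box_free A \<and> box_free B)"


section \<open>Terms\<close>

text \<open>Bit strings are boolean lists, with \<^term>\<open>False\<close> for the bit 0 and \<^term>\<open>True\<close> for
  the bit 1. Variables are de Bruijn indices, so that terms are identified up to renaming of
  bound variables.\<close>

type_synonym bits = "bool list"

datatype trm =
    Var nat
  | Const bits
  | Lam aspect ty trm
  | Zero trm
  | One trm
  | Tail trm
  | App trm trm
  | Case ty trm trm trm trm
  | Rec ty trm trm trm trm
  | Rand

fun is_value :: "trm \<Rightarrow> bool" where
  "is_value (Const m) = True"
| "is_value (Lam a A r) = True"
| "is_value _ = False"

text \<open>Only closed terms \<open>v\<close> are ever substituted, so \<open>v\<close> need not be lifted under binders.\<close>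

fun subst :: "nat \<Rightarrow> trm \<Rightarrow> trm \<Rightarrow> trm" where
  "subst k v (Var n) = (if n = k then v else if k < n then Var (n - 1) else Var n)"
| "subst k v (Const m) = Const m"
| "subst k v (Lam a A t) = Lam a A (subst (Suc k) v t)"
| "subst k v (Zero t) = Zero (subst k v t)"
| "subst k v (One t) = One (subst k v t)"
| "subst k v (Tail t) = Tail (subst k v t)"
| "subst k v (App t s) = App (subst k v t) (subst k v s)"
| "subst k v (Case A t t0 t1 te) =
     Case A (subst k v t) (subst k v t0) (subst k v t1) (subst k v te)"
| "subst k v (Rec A t t0 t1 te) =
     Rec A (subst k v t) (subst k v t0) (subst k v t1) (subst k v te)"
| "subst k v Rand = Rand"


section \<open>Typing\<close>

text \<open>Finiteness of typing contexts is not demanded: the contexts in a derivation of a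
  judgement with finite context are finite, since every rule other than abstraction only passes to
  subcontexts.\<close>

type_synonym tctx = "nat \<Rightarrow> (aspect \<times> ty) option"

text \<open>Extension with a declaration for the innermost variable (index 0).\<close>

definition ext :: "aspect \<Rightarrow> ty \<Rightarrow> tctx \<Rightarrow> tctx" where
  "ext a A \<Gamma> = (\<lambda>n. case n of 0 \<Rightarrow> Some (a, A) | Suc k \<Rightarrow> \<Gamma> k)"

definition disjoint_ctxs :: "tctx list \<Rightarrow> bool" where
  "disjoint_ctxs Gs \<longleftrightarrow> sorted_wrt (\<lambda>\<Gamma> \<Delta>. dom \<Gamma> \<inter> dom \<Delta> = {}) Gs"

definition str_ctx :: "tctx \<Rightarrow> bool" where
  "str_ctx \<Gamma> \<longleftrightarrow> (\<forall>x a A. \<Gamma> x = Some (a, A) \<longrightarrow> A = TStr)"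

definition ctx_le :: "tctx \<Rightarrow> aspect \<Rightarrow> bool" where
  "ctx_le \<Gamma> a \<longleftrightarrow> (\<forall>x b A. \<Gamma> x = Some (b, A) \<longrightarrow> asp_le b a)"

text \<open>A comma and a semicolon both denote disjoint union (\<open>++\<close> with pairwise disjoint
  domains); everything to the left of a semicolon has type \<open>Str\<close>. A term typable in the empty
  context is closed.\<close>

inductive has_type :: "tctx \<Rightarrow> trm \<Rightarrow> ty \<Rightarrow> bool"  ("_ \<turnstile> _ : _" [50, 50, 50] 50) where
  T_Var: "\<Gamma> x = Some (a, A) \<Longrightarrow> \<Gamma> \<turnstile> Var x : A"
| T_Const: "\<Gamma> \<turnstile> Const m : TStr"
| T_Rand: "\<Gamma> \<turnstile> Rand : TStr"
| T_Zero: "\<Gamma> \<turnstile> t : TStr \<Longrightarrow> \<Gamma> \<turnstile> Zero t : TStr"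
| T_One: "\<Gamma> \<turnstile> t : TStr \<Longrightarrow> \<Gamma> \<turnstile> One t : TStr"
| T_Tail: "\<Gamma> \<turnstile> t : TStr \<Longrightarrow> \<Gamma> \<turnstile> Tail t : TStr"
| T_Lam: "ext a A \<Gamma> \<turnstile> t : B \<Longrightarrow> \<Gamma> \<turnstile> Lam a A t : Arr a A B"
| T_Sub: "\<Gamma> \<turnstile> t : A \<Longrightarrow> subtype A B \<Longrightarrow> \<Gamma> \<turnstile> t : B"
| T_App: "\<lbrakk> disjoint_ctxs [\<Gamma>, \<Delta>1, \<Delta>2]; str_ctx \<Gamma>;
           \<Gamma> ++ \<Delta>1 \<turnstile> t : Arr a A B; \<Gamma> ++ \<Delta>2 \<turnstile> s : A; ctx_le (\<Gamma> ++ \<Delta>2) a \<rbrakk>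
         \<Longrightarrow> \<Gamma> ++ \<Delta>1 ++ \<Delta>2 \<turnstile> App t s : B"
| T_Case: "\<lbrakk> disjoint_ctxs [\<Gamma>, \<Delta>1, \<Delta>2, \<Delta>3, \<Delta>4]; str_ctx \<Gamma>;
            \<Gamma> ++ \<Delta>1 \<turnstile> t : TStr; \<Gamma> ++ \<Delta>2 \<turnstile> t0 : A; \<Gamma> ++ \<Delta>3 \<turnstile> t1 : A; \<Gamma> ++ \<Delta>4 \<turnstile> te : A \<rbrakk>
          \<Longrightarrow> \<Gamma> ++ \<Delta>1 ++ \<Delta>2 ++ \<Delta>3 ++ \<Delta>4 \<turnstile> Case A t t0 t1 te : A"
| T_Rec: "\<lbrakk> disjoint_ctxs [\<Gamma>1, \<Gamma>2, \<Gamma>3, \<Delta>1, \<Delta>2]; str_ctx (\<Gamma>1 ++ \<Gamma>2 ++ \<Gamma>3);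
           \<Gamma>1 ++ \<Delta>1 \<turnstile> t : TStr;
           \<Gamma>1 ++ \<Gamma>2 \<turnstile> t0 : Arr Box TStr (Arr Black A A);
           \<Gamma>1 ++ \<Gamma>3 \<turnstile> t1 : Arr Box TStr (Arr Black A A);
           \<Gamma>1 ++ \<Gamma>2 ++ \<Gamma>3 ++ \<Delta>2 \<turnstile> te : A;
           ctx_le (\<Gamma>1 ++ \<Delta>1) Box; box_free A \<rbrakk>
         \<Longrightarrow> \<Gamma>1 ++ \<Gamma>2 ++ \<Gamma>3 ++ \<Delta>1 ++ \<Delta>2 \<turnstile> Rec A t t0 t1 te : A"

abbreviation closed_type :: "trm \<Rightarrow> ty \<Rightarrow> bool"  ("\<turnstile> _ : _" [50, 50] 50) where
  "\<turnstile> t : A \<equiv> Map.empty \<turnstile> t : A"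


section \<open>Semantics\<close>

text \<open>The big-step equations are read as a recursive definition of a subdistribution (least
  solution); \<^term>\<open>return_pmf None\<close> is the null subdistribution and is used for stuck terms,
  which are never reached from closed typable ones.\<close>

partial_function (spmf) eval :: "trm \<Rightarrow> trm spmf" where
  "eval t = (case t of
       Var x \<Rightarrow> return_pmf None
     | Const m \<Rightarrow> return_spmf (Const m)
     | Lam a A r \<Rightarrow> return_spmf (Lam a A r)
     | Zero s \<Rightarrow> bind_spmf (eval s) (\<lambda>v. case v of
           Const m \<Rightarrow> return_spmf (Const (False # m)) | _ \<Rightarrow> return_pmf None)
     | One s \<Rightarrow> bind_spmf (eval s) (\<lambda>v. case v of
           Const m \<Rightarrow> return_spmf (Const (True # m)) | _ \<Rightarrow> return_pmf None)
     | Tail s \<Rightarrow> bind_spmf (eval s) (\<lambda>v. case v of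
           Const m \<Rightarrow> return_spmf (Const (tl m)) | _ \<Rightarrow> return_pmf None)
     | App f s \<Rightarrow> bind_spmf (eval f) (\<lambda>w. bind_spmf (eval s) (\<lambda>v. case w of
           Lam a A r \<Rightarrow> eval (subst 0 v r) | _ \<Rightarrow> return_pmf None))
     | Case A s t0 t1 te \<Rightarrow> bind_spmf (eval s) (\<lambda>v. case v of
           Const m \<Rightarrow> (case m of [] \<Rightarrow> eval te | b # n \<Rightarrow> eval (if b then t1 else t0))
         | _ \<Rightarrow> return_pmf None)
     | Rec A s t0 t1 te \<Rightarrow> bind_spmf (eval s) (\<lambda>v. case v of
           Const m \<Rightarrow> (case m of
               [] \<Rightarrow> eval te
             | b # n \<Rightarrow> eval (App (App (if b then t1 else t0) (Const (b # n)))
                                 (Rec A (Const n) t0 t1 te)))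
         | _ \<Rightarrow> return_pmf None)
     | Rand \<Rightarrow> map_spmf (\<lambda>b. Const [b]) coin_spmf)"


section \<open>Contexts\<close>

datatype ctx =
    CTerm trm
  | Hole
  | CLam aspect ty ctx
  | CAppL ctx trm
  | CAppR trm ctx
  | CZero ctx
  | COne ctx
  | CTail ctx
  | CCase ty ctx trm trm trm
  | CBranch ty trm ctx ctx ctx
  | CRec ty ctx trm trm trm

fun holes :: "ctx \<Rightarrow> nat" where
  "holes (CTerm t) = 0"
| "holes Hole = 1"
| "holes (CLam a A C) = holes C"
| "holes (CAppL C t) = holes C"
| "holes (CAppR t C) = holes C"
| "holes (CZero C) = holes C"
| "holes (COne C) = holes C"
| "holes (CTail C) = holes C"
| "holes (CCase A C t0 t1 te) = holes C"
| "holes (CBranch A t C0 C1 Ce) = holes C0 + holes C1 + holes Ce"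
| "holes (CRec A C t0 t1 te) = holes C"

text \<open>Holes are filled with closed terms only, hence no lifting under \<^const>\<open>CLam\<close>.\<close>

fun fill :: "ctx \<Rightarrow> trm \<Rightarrow> trm" where
  "fill (CTerm t) u = t"
| "fill Hole u = u"
| "fill (CLam a A C) u = Lam a A (fill C u)"
| "fill (CAppL C t) u = App (fill C u) t"
| "fill (CAppR t C) u = App t (fill C u)"
| "fill (CZero C) u = Zero (fill C u)"
| "fill (COne C) u = One (fill C u)"
| "fill (CTail C) u = Tail (fill C u)"
| "fill (CCase A C t0 t1 te) u = Case A (fill C u) t0 t1 te"
| "fill (CBranch A t C0 C1 Ce) u = Case A t (fill C0 u) (fill C1 u) (fill Ce u)"
| "fill (CRec A C t0 t1 te) u = Rec A (fill C u) t0 t1 te"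

definition ctx_typed :: "ctx \<Rightarrow> ty \<Rightarrow> ty \<Rightarrow> bool" where
  "ctx_typed C A B \<longleftrightarrow> (\<forall>t. \<turnstile> t : A \<longrightarrow> \<turnstile> fill C t : B)"


section \<open>Term distributions and trace distance\<close>

definition term_dist :: "ty \<Rightarrow> trm pmf \<Rightarrow> bool" where
  "term_dist A \<T> \<longleftrightarrow> (\<forall>t \<in> set_pmf \<T>. \<turnstile> t : A)"

definition fill_dist :: "ctx \<Rightarrow> trm pmf \<Rightarrow> trm pmf" where
  "fill_dist C \<T> = map_pmf (fill C) \<T>"

datatype trace = View "bits set" | Pass trm trace

inductive compatible :: "ty \<Rightarrow> trace \<Rightarrow> bool" where
  "finite M \<Longrightarrow> compatible TStr (View M)"
| "is_value v \<Longrightarrow> \<turnstile> v : B \<Longrightarrow> compatible C S \<Longrightarrow> compatible (Arr b B C) (Pass v S)"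

definition pass :: "trm \<Rightarrow> trm spmf \<Rightarrow> trm spmf" where
  "pass v \<D> = bind_spmf \<D> (\<lambda>w. case w of Lam a A r \<Rightarrow> eval (subst 0 v r) | _ \<Rightarrow> return_pmf None)"

fun run :: "trm spmf \<Rightarrow> trace \<Rightarrow> real" where
  "run \<D> (View M) = (\<Sum>m\<in>M. spmf \<D> (Const m))"
| "run \<D> (Pass v S) = run (pass v \<D>) S"

definition trace_prob :: "trm pmf \<Rightarrow> trace \<Rightarrow> real" where
  "trace_prob \<T> S = run (bind_pmf \<T> eval) S"

text \<open>Every type has a compatible trace and the differences are at most 1, so the real-valued
  supremum is the genuine one.\<close>

definition trace_distance :: "ty \<Rightarrow> trm pmf \<Rightarrow> trm pmf \<Rightarrow> real" where
  "trace_distance A \<T> \<S> = (SUP S \<in> {S. compatible A S}. \<bar>trace_prob \<T> S - trace_prob \<S> S\<bar>)"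

end

theory Submission
  imports Defs
begin

text \<open>A value of arrow type is used at most once by a typable term, so filling a hole with a sample
  from a term distribution amounts to evaluating the sample at most once, when the hole reaches an
  evaluation position, and then only passing it values or viewing the resulting string: this is a
  mixture of traces. This is made precise by a logical relation, defined by recursion on types for a
  fixed bound \<open>d\<close>: good values terminate on good values, and map pairs of distributions at trace
  distance at most \<open>d\<close> to such pairs. Termination is essential, since an unused diverging argument
  would otherwise be distinguished from an unused converging one. At type \<open>Str\<close> no linearity is
  needed, because there the trace distance is the total variation distance, which no kernel
  increases.\<close>

section \<open>Substitution and occurrences\<close>

text \<open>The hypothesis on \<open>C\<close> speaks of closed fillings only and gives no
  derivation for \<open>C\<close> with an open hole. So one filling is chosen, a closed value
  \<open>inhab A\<close> whose types are exactly the supertypes of \<open>A\<close>; its derivation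
  can be reread with a variable of type \<open>A\<close> in place of the hole. Nonexpansiveness has
  to be stated for whole distributions: closeness of \<open>\<T>\<close> and \<open>\<S>\<close>
  says nothing about pairs of sampled terms, since a mixture of deterministic terms may agree on all
  traces with one randomized term. The relation keeps one \<open>d\<close> throughout because a
  single use spends it once; a second use could cost more. In an application, a perturbed function
  is tested by passing it values, whereas a perturbed argument needs a nonexpansive function; this
  is why nonexpansiveness is a clause of \<open>good\<close> and not of
  \<open>close\<close>.\<close>

text \<open>\<open>csub k \<sigma>\<close> replaces all variables from index \<open>k\<close> on; the terms \<open>\<sigma> n\<close> are meant to be closed
  and are therefore not lifted under binders.\<close>

fun csub :: "nat \<Rightarrow> (nat \<Rightarrow> trm) \<Rightarrow> trm \<Rightarrow> trm" where
  "csub k \<sigma> (Var n) = (if n < k then Var n else \<sigma> (n - k))"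
| "csub k \<sigma> (Const m) = Const m"
| "csub k \<sigma> (Lam a A t) = Lam a A (csub (Suc k) \<sigma> t)"
| "csub k \<sigma> (Zero t) = Zero (csub k \<sigma> t)"
| "csub k \<sigma> (One t) = One (csub k \<sigma> t)"
| "csub k \<sigma> (Tail t) = Tail (csub k \<sigma> t)"
| "csub k \<sigma> (App t s) = App (csub k \<sigma> t) (csub k \<sigma> s)"
| "csub k \<sigma> (Case A t t0 t1 te) =
     Case A (csub k \<sigma> t) (csub k \<sigma> t0) (csub k \<sigma> t1) (csub k \<sigma> te)"
| "csub k \<sigma> (Rec A t t0 t1 te) =
     Rec A (csub k \<sigma> t) (csub k \<sigma> t0) (csub k \<sigma> t1) (csub k \<sigma> te)"
| "csub k \<sigma> Rand = Rand"

fun scoped :: "nat \<Rightarrow> trm \<Rightarrow> bool" where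
  "scoped k (Var n) = (n < k)"
| "scoped k (Const m) = True"
| "scoped k (Lam a A t) = scoped (Suc k) t"
| "scoped k (Zero t) = scoped k t"
| "scoped k (One t) = scoped k t"
| "scoped k (Tail t) = scoped k t"
| "scoped k (App t s) = (scoped k t \<and> scoped k s)"
| "scoped k (Case A t t0 t1 te) = (scoped k t \<and> scoped k t0 \<and> scoped k t1 \<and> scoped k te)"
| "scoped k (Rec A t t0 t1 te) = (scoped k t \<and> scoped k t0 \<and> scoped k t1 \<and> scoped k te)"
| "scoped k Rand = True"

text \<open>Step terms of a recursion may be evaluated repeatedly, so an occurrence there counts
  twice; thus \<open>occ y t \<le> 1\<close> says that \<open>y\<close> is used linearly.\<close>

fun occ :: "nat \<Rightarrow> trm \<Rightarrow> nat" where
  "occ y (Var n) = (if n = y then 1 else 0)"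
| "occ y (Const m) = 0"
| "occ y (Lam a A t) = occ (Suc y) t"
| "occ y (Zero t) = occ y t"
| "occ y (One t) = occ y t"
| "occ y (Tail t) = occ y t"
| "occ y (App t s) = occ y t + occ y s"
| "occ y (Case A t t0 t1 te) = occ y t + occ y t0 + occ y t1 + occ y te"
| "occ y (Rec A t t0 t1 te) = occ y t + 2 * occ y t0 + 2 * occ y t1 + occ y te"
| "occ y Rand = 0"

lemma scoped_subst: "scoped k t \<Longrightarrow> k \<le> j \<Longrightarrow> subst j u t = t"
  by (induction t arbitrary: k j) auto

lemma scoped_csub: "scoped k t \<Longrightarrow> k \<le> j \<Longrightarrow> csub j \<sigma> t = t"
  by (induction t arbitrary: k j) auto

lemma scoped_occ: "scoped k t \<Longrightarrow> k \<le> j \<Longrightarrow> occ j t = 0"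
  by (induction t arbitrary: k j) auto

text \<open>The beta step: filling the bound variable after \<open>csub\<close> prepends
  \<open>u\<close> to the substitution. Closedness keeps \<open>subst\<close> from touching the
  inserted terms.\<close>

lemma subst_csub:
  assumes "\<And>n. scoped 0 (\<sigma> n)"
  shows "subst k u (csub (Suc k) \<sigma> t) = csub k (case_nat u \<sigma>) t"
proof (induction t arbitrary: k)
  case (Var n)
  show ?case
  proof (cases "n > k")
    case True
    then obtain j where "n = k + Suc j"
      using less_iff_Suc_add by auto
    then show ?thesis
      using scoped_subst[OF assms, of k u] by simp
  qed auto
qed auto

text \<open>Under \<open>k\<close> binders the entry \<open>\<sigma> y\<close> serves the index
  \<open>y + k\<close>. With \<open>s' = \<sigma> y\<close> the right-hand side is
  \<open>csub k \<sigma> t\<close>.\<close>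

lemma csub_upd_occ: "occ (y + k) t = 0 \<Longrightarrow> csub k (\<sigma>(y := s)) t = csub k (\<sigma>(y := s')) t"
  by (induction t arbitrary: k) auto


section \<open>Typing\<close>

lemma map_le_split:
  assumes "G \<subseteq>\<^sub>m G'"
  obtains E where "dom E \<inter> dom G = {}" and "G' = G ++ E"
proof
  show "dom (G' |` (- dom G)) \<inter> dom G = {}"
    by auto
  show "G' = G ++ G' |` (- dom G)"
    using assms by (auto simp: fun_eq_iff map_add_def map_le_def restrict_map_def dom_def split: option.splits)
qed

lemma ext_mono: "\<Gamma> \<subseteq>\<^sub>m \<Gamma>' \<Longrightarrow> ext a A \<Gamma> \<subseteq>\<^sub>m ext a A \<Gamma>'"
  by (auto simp: map_le_def ext_def dom_def split: nat.splits)

lemma ext_simps [simp]: "ext a A \<Gamma> 0 = Some (a, A)" "ext a A \<Gamma> (Suc n) = \<Gamma> n"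
  by (auto simp: ext_def)

lemma dom_disjoint_iff: "dom f \<inter> dom g = {} \<longleftrightarrow> (\<forall>x. f x = None \<or> g x = None)"
  unfolding dom_def disjoint_iff mem_Collect_eq by metis

lemma map_le_iff: "f \<subseteq>\<^sub>m g \<longleftrightarrow> (\<forall>x y. f x = Some y \<longrightarrow> g x = Some y)"
  by (auto simp: map_le_def dom_def)

lemma ctx_submaps_App:
  assumes "disjoint_ctxs [G, D1, D2]"
  shows "G ++ D1 \<subseteq>\<^sub>m G ++ D1 ++ D2" "G ++ D2 \<subseteq>\<^sub>m G ++ D1 ++ D2"
  using assms
  by (simp_all add: disjoint_ctxs_def dom_disjoint_iff map_le_iff map_add_Some_iff)
     (metis option.distinct(1))+

lemma ctx_submaps_Case:
  assumes "disjoint_ctxs [G, D1, D2, D3, D4]"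
  shows "G ++ D1 \<subseteq>\<^sub>m G ++ D1 ++ D2 ++ D3 ++ D4" "G ++ D2 \<subseteq>\<^sub>m G ++ D1 ++ D2 ++ D3 ++ D4"
    "G ++ D3 \<subseteq>\<^sub>m G ++ D1 ++ D2 ++ D3 ++ D4" "G ++ D4 \<subseteq>\<^sub>m G ++ D1 ++ D2 ++ D3 ++ D4"
  using assms
  by (simp_all add: disjoint_ctxs_def dom_disjoint_iff map_le_iff map_add_Some_iff)
     (metis option.distinct(1))+

lemma ctx_submaps_Rec:
  assumes "disjoint_ctxs [G1, G2, G3, D1, D2]"
  shows "G1 ++ D1 \<subseteq>\<^sub>m G1 ++ G2 ++ G3 ++ D1 ++ D2" "G1 ++ G2 \<subseteq>\<^sub>m G1 ++ G2 ++ G3 ++ D1 ++ D2"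
    "G1 ++ G3 \<subseteq>\<^sub>m G1 ++ G2 ++ G3 ++ D1 ++ D2"
    "G1 ++ G2 ++ G3 ++ D2 \<subseteq>\<^sub>m G1 ++ G2 ++ G3 ++ D1 ++ D2"
  using assms
  by (simp_all add: disjoint_ctxs_def dom_disjoint_iff map_le_iff map_add_Some_iff)
     (metis option.distinct(1))+

text \<open>The surplus \<open>E\<close> has to join a single component of the split, one free of
  side conditions: \<open>\<Delta>1\<close> for application and case, \<open>\<Delta>2\<close> (that
  of the base term) for recursion.\<close>

lemma weakening: "\<Gamma> \<turnstile> t : A \<Longrightarrow> \<Gamma> \<subseteq>\<^sub>m \<Gamma>' \<Longrightarrow> \<Gamma>' \<turnstile> t : A"
proof (induction arbitrary: \<Gamma>' rule: has_type.induct)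
  case (T_App \<Gamma> \<Delta>1 \<Delta>2 t a A B s)
  from T_App.prems obtain E where E: "dom E \<inter> dom (\<Gamma> ++ \<Delta>1 ++ \<Delta>2) = {}" "\<Gamma>' = (\<Gamma> ++ \<Delta>1 ++ \<Delta>2) ++ E"
    by (rule map_le_split)
  have disj: "disjoint_ctxs [\<Gamma>, \<Delta>1 ++ E, \<Delta>2]"
    using T_App.hyps(1) E(1) by (auto simp: disjoint_ctxs_def)
  have "\<Delta>2 ++ E = E ++ \<Delta>2"
    using E(1) by (intro map_add_comm) auto
  then have eq: "\<Gamma>' = \<Gamma> ++ (\<Delta>1 ++ E) ++ \<Delta>2"
    unfolding E(2) by (metis map_add_assoc)
  have "\<Gamma> ++ \<Delta>1 \<subseteq>\<^sub>m \<Gamma> ++ (\<Delta>1 ++ E)"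
    using E(1) by (auto simp: map_le_iff map_add_Some_iff)
  then show ?case
    unfolding eq using T_App disj by (blast intro: has_type.T_App map_le_refl)
next
  case (T_Case \<Gamma> \<Delta>1 \<Delta>2 \<Delta>3 \<Delta>4 t t0 A t1 te)
  from T_Case.prems obtain E where E: "dom E \<inter> dom (\<Gamma> ++ \<Delta>1 ++ \<Delta>2 ++ \<Delta>3 ++ \<Delta>4) = {}"
    "\<Gamma>' = (\<Gamma> ++ \<Delta>1 ++ \<Delta>2 ++ \<Delta>3 ++ \<Delta>4) ++ E"
    by (rule map_le_split)
  have disj: "disjoint_ctxs [\<Gamma>, \<Delta>1 ++ E, \<Delta>2, \<Delta>3, \<Delta>4]"
    using T_Case.hyps(1) E(1) by (auto simp: disjoint_ctxs_def)
  have "(\<Delta>2 ++ \<Delta>3 ++ \<Delta>4) ++ E = E ++ (\<Delta>2 ++ \<Delta>3 ++ \<Delta>4)"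
    using E(1) by (intro map_add_comm) auto
  then have eq: "\<Gamma>' = \<Gamma> ++ (\<Delta>1 ++ E) ++ \<Delta>2 ++ \<Delta>3 ++ \<Delta>4"
    unfolding E(2) by (metis map_add_assoc)
  have "\<Gamma> ++ \<Delta>1 \<subseteq>\<^sub>m \<Gamma> ++ (\<Delta>1 ++ E)"
    using E(1) by (auto simp: map_le_iff map_add_Some_iff)
  then show ?case
    unfolding eq using T_Case disj by (blast intro: has_type.T_Case map_le_refl)
next
  case (T_Rec \<Gamma>1 \<Gamma>2 \<Gamma>3 \<Delta>1 \<Delta>2 t t0 A t1 te)
  from T_Rec.prems obtain E where E: "dom E \<inter> dom (\<Gamma>1 ++ \<Gamma>2 ++ \<Gamma>3 ++ \<Delta>1 ++ \<Delta>2) = {}"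
    "\<Gamma>' = (\<Gamma>1 ++ \<Gamma>2 ++ \<Gamma>3 ++ \<Delta>1 ++ \<Delta>2) ++ E"
    by (rule map_le_split)
  have disj: "disjoint_ctxs [\<Gamma>1, \<Gamma>2, \<Gamma>3, \<Delta>1, \<Delta>2 ++ E]"
    using T_Rec.hyps(1) E(1) by (auto simp: disjoint_ctxs_def)
  have eq: "\<Gamma>' = \<Gamma>1 ++ \<Gamma>2 ++ \<Gamma>3 ++ \<Delta>1 ++ (\<Delta>2 ++ E)"
    unfolding E(2) by simp
  have "\<Gamma>1 ++ \<Gamma>2 ++ \<Gamma>3 ++ \<Delta>2 \<subseteq>\<^sub>m \<Gamma>1 ++ \<Gamma>2 ++ \<Gamma>3 ++ (\<Delta>2 ++ E)"
    using E(1) by (auto simp: map_le_iff map_add_Some_iff)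
  then show ?case
    unfolding eq using T_Rec disj by (blast intro: has_type.T_Rec map_le_refl)
next
  case (T_Lam a A \<Gamma> t B)
  then show ?case
    by (blast intro: has_type.T_Lam ext_mono)
qed (auto intro: has_type.intros simp: map_le_iff)

section \<open>Substituting closed terms\<close>

lemma restrict_map_add: "(f ++ g) |` S = f |` S ++ g |` S"
  by (auto simp: fun_eq_iff restrict_map_def map_add_def split: option.splits)

lemma disjoint_ctxs_restrict: "disjoint_ctxs Gs \<Longrightarrow> disjoint_ctxs (map (\<lambda>G. G |` S) Gs)"
  unfolding disjoint_ctxs_def by (induction Gs) (auto simp: dom_disjoint_iff restrict_map_def)

lemma str_ctx_restrict: "str_ctx \<Gamma> \<Longrightarrow> str_ctx (\<Gamma> |` S)"
  by (auto simp: str_ctx_def restrict_map_def split: if_splits)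

lemma ctx_le_restrict: "ctx_le \<Gamma> a \<Longrightarrow> ctx_le (\<Gamma> |` S) a"
  by (auto simp: ctx_le_def restrict_map_def split: if_splits)

text \<open>Closed terms need nothing from the split contexts, so each premise keeps its own context
  cut down to the \<open>k\<close> bound variables; disjointness and the side conditions survive the
  cut.\<close>

lemma csub_typing:
  "\<Gamma> \<turnstile> t : A \<Longrightarrow> (\<And>n a B. \<Gamma> (n + k) = Some (a, B) \<Longrightarrow> \<turnstile> \<sigma> n : B) \<Longrightarrow> \<Gamma> |` {..<k} \<turnstile> csub k \<sigma> t : A"
proof (induction arbitrary: k rule: has_type.induct)
  case (T_Var \<Gamma> x a A)
  show ?case
  proof (cases "x < k")
    case True
    then show ?thesis
      using T_Var by (auto intro: has_type.T_Var)
  next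
    case False
    then have "\<turnstile> \<sigma> (x - k) : A"
      using T_Var by (metis le_add_diff_inverse2 not_less)
    then show ?thesis
      using False by (auto intro: weakening)
  qed
next
  case (T_Lam a A \<Gamma> t B)
  have "ext a A \<Gamma> |` {..<Suc k} = ext a A (\<Gamma> |` {..<k})"
    by (auto simp: fun_eq_iff ext_def restrict_map_def split: nat.splits)
  then show ?case
    using T_Lam.IH[of "Suc k"] T_Lam.prems by (auto intro: has_type.T_Lam)
next
  case (T_App \<Gamma> \<Delta>1 \<Delta>2 t a A B s)
  have sub: "\<And>n a B. G (n + k) = Some (a, B) \<Longrightarrow> \<turnstile> \<sigma> n : B"
    if "G \<subseteq>\<^sub>m \<Gamma> ++ \<Delta>1 ++ \<Delta>2" for G
    using that T_App.prems unfolding map_le_iff by blast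
  have "\<Gamma> |` {..<k} ++ \<Delta>1 |` {..<k} \<turnstile> csub k \<sigma> t : Arr a A B"
    "\<Gamma> |` {..<k} ++ \<Delta>2 |` {..<k} \<turnstile> csub k \<sigma> s : A"
    using T_App.IH[of k, OF sub] ctx_submaps_App[OF T_App.hyps(1)]
    unfolding restrict_map_add by simp_all
  then show ?case
    using disjoint_ctxs_restrict[OF T_App.hyps(1), of "{..<k}"] T_App.hyps
      ctx_le_restrict[OF T_App.hyps(5), of "{..<k}"]
    unfolding restrict_map_add csub.simps
    by (intro has_type.T_App str_ctx_restrict) auto
next
  case (T_Case \<Gamma> \<Delta>1 \<Delta>2 \<Delta>3 \<Delta>4 t t0 A t1 te)
  have sub: "\<And>n a B. G (n + k) = Some (a, B) \<Longrightarrow> \<turnstile> \<sigma> n : B"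
    if "G \<subseteq>\<^sub>m \<Gamma> ++ \<Delta>1 ++ \<Delta>2 ++ \<Delta>3 ++ \<Delta>4" for G
    using that T_Case.prems unfolding map_le_iff by blast
  have "\<Gamma> |` {..<k} ++ \<Delta>1 |` {..<k} \<turnstile> csub k \<sigma> t : TStr"
    "\<Gamma> |` {..<k} ++ \<Delta>2 |` {..<k} \<turnstile> csub k \<sigma> t0 : A"
    "\<Gamma> |` {..<k} ++ \<Delta>3 |` {..<k} \<turnstile> csub k \<sigma> t1 : A"
    "\<Gamma> |` {..<k} ++ \<Delta>4 |` {..<k} \<turnstile> csub k \<sigma> te : A"
    using T_Case.IH[of k, OF sub] ctx_submaps_Case[OF T_Case.hyps(1)]
    unfolding restrict_map_add by simp_all
  then show ?case
    using disjoint_ctxs_restrict[OF T_Case.hyps(1), of "{..<k}"] T_Case.hyps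
    unfolding restrict_map_add csub.simps
    by (intro has_type.T_Case str_ctx_restrict) auto
next
  case (T_Rec \<Gamma>1 \<Gamma>2 \<Gamma>3 \<Delta>1 \<Delta>2 t t0 A t1 te)
  have sub: "\<And>n a B. G (n + k) = Some (a, B) \<Longrightarrow> \<turnstile> \<sigma> n : B"
    if "G \<subseteq>\<^sub>m \<Gamma>1 ++ \<Gamma>2 ++ \<Gamma>3 ++ \<Delta>1 ++ \<Delta>2" for G
    using that T_Rec.prems unfolding map_le_iff by blast
  have "\<Gamma>1 |` {..<k} ++ \<Delta>1 |` {..<k} \<turnstile> csub k \<sigma> t : TStr"
    "\<Gamma>1 |` {..<k} ++ \<Gamma>2 |` {..<k} \<turnstile> csub k \<sigma> t0 : Arr Box TStr (Arr Black A A)"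
    "\<Gamma>1 |` {..<k} ++ \<Gamma>3 |` {..<k} \<turnstile> csub k \<sigma> t1 : Arr Box TStr (Arr Black A A)"
    "\<Gamma>1 |` {..<k} ++ \<Gamma>2 |` {..<k} ++ \<Gamma>3 |` {..<k} ++ \<Delta>2 |` {..<k} \<turnstile> csub k \<sigma> te : A"
    using T_Rec.IH[of k, OF sub] ctx_submaps_Rec[OF T_Rec.hyps(1)]
    unfolding restrict_map_add by simp_all
  then show ?case
    using disjoint_ctxs_restrict[OF T_Rec.hyps(1), of "{..<k}"] T_Rec.hyps
      str_ctx_restrict[OF T_Rec.hyps(2), of "{..<k}"] ctx_le_restrict[OF T_Rec.hyps(7), of "{..<k}"]
    unfolding restrict_map_add csub.simps
    by (intro has_type.T_Rec) auto
qed (auto intro: has_type.intros)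

lemma csub_typing_closed:
  assumes "\<Gamma> \<turnstile> t : A" and "\<And>n a B. \<Gamma> n = Some (a, B) \<Longrightarrow> \<turnstile> \<sigma> n : B"
  shows "\<turnstile> csub 0 \<sigma> t : A"
  using csub_typing[OF assms(1), of 0 \<sigma>] assms(2) by simp

section \<open>Scoping and linearity read off a derivation\<close>

lemma has_type_scoped: "\<Gamma> \<turnstile> t : A \<Longrightarrow> dom \<Gamma> \<subseteq> {..<k} \<Longrightarrow> scoped k t"
proof (induction arbitrary: k rule: has_type.induct)
  case (T_Lam a A \<Gamma> t B)
  have "dom (ext a A \<Gamma>) \<subseteq> {..<Suc k}"
  proof
    fix x
    assume "x \<in> dom (ext a A \<Gamma>)"
    then show "x \<in> {..<Suc k}"
      using subsetD[OF T_Lam.prems domI] by (cases x) auto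
  qed
  then show ?case
    using T_Lam.IH by simp
qed auto

lemma has_type_occ: "\<Gamma> \<turnstile> t : A \<Longrightarrow> \<Gamma> y = None \<Longrightarrow> occ y t = 0"
  by (induction arbitrary: y rule: has_type.induct) (auto simp: map_add_None)

lemma disjoint_ctxs_at:
  "disjoint_ctxs Gs \<Longrightarrow> sorted_wrt (\<lambda>\<Gamma> \<Delta>. \<Gamma> y = None \<or> \<Delta> y = None) Gs"
  unfolding disjoint_ctxs_def dom_disjoint_iff
  by (induction Gs) auto

text \<open>\<open>str_ctx\<close> keeps \<open>y\<close> out of the shared contexts, and by
  disjointness at most one of the others declares it. Step terms see shared contexts alone, so the
  factor 2 in \<open>occ\<close> multiplies zero.\<close>

lemma occ_linear: "\<Gamma> \<turnstile> t : B \<Longrightarrow> \<Gamma> y = Some (a, A) \<Longrightarrow> A \<noteq> TStr \<Longrightarrow> occ y t \<le> 1"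
proof (induction arbitrary: y rule: has_type.induct)
  case (T_App \<Gamma> \<Delta>1 \<Delta>2 t b A' B s)
  have none: "\<Gamma> y = None"
    using disjoint_ctxs_at[OF T_App.hyps(1), of y] T_App.hyps(2) T_App.prems
    by (cases "\<Gamma> y")
       (auto simp: str_ctx_def map_add_Some_iff)
  have "occ y t \<le> (if \<Delta>1 y = None then 0 else 1)" "occ y s \<le> (if \<Delta>2 y = None then 0 else 1)"
    using T_App.prems T_App.IH[of y] disjoint_ctxs_at[OF T_App.hyps(1), of y] none
      T_App.hyps(3,4)[THEN has_type_occ, of y]
    by (auto simp: map_add_Some_iff)
  then show ?case
    using disjoint_ctxs_at[OF T_App.hyps(1), of y] by (auto split: if_splits)
next
  case (T_Case \<Gamma> \<Delta>1 \<Delta>2 \<Delta>3 \<Delta>4 t t0 A' t1 te)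
  have none: "\<Gamma> y = None"
    using disjoint_ctxs_at[OF T_Case.hyps(1), of y] T_Case.hyps(2) T_Case.prems
    by (cases "\<Gamma> y") (auto simp: str_ctx_def map_add_Some_iff)
  have "occ y t \<le> (if \<Delta>1 y = None then 0 else 1)" "occ y t0 \<le> (if \<Delta>2 y = None then 0 else 1)"
    "occ y t1 \<le> (if \<Delta>3 y = None then 0 else 1)" "occ y te \<le> (if \<Delta>4 y = None then 0 else 1)"
    using T_Case.prems T_Case.IH[of y] disjoint_ctxs_at[OF T_Case.hyps(1), of y] none
      T_Case.hyps(3-6)[THEN has_type_occ, of y]
    by (auto simp: map_add_Some_iff)
  then show ?case
    using disjoint_ctxs_at[OF T_Case.hyps(1), of y] by (auto split: if_splits)
next
  case (T_Rec \<Gamma>1 \<Gamma>2 \<Gamma>3 \<Delta>1 \<Delta>2 t t0 A' t1 te)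
  have none: "\<Gamma>1 y = None" "\<Gamma>2 y = None" "\<Gamma>3 y = None"
    using disjoint_ctxs_at[OF T_Rec.hyps(1), of y] T_Rec.hyps(2) T_Rec.prems
    by (cases "\<Gamma>1 y"; cases "\<Gamma>2 y"; cases "\<Gamma>3 y";
        auto simp: str_ctx_def map_add_Some_iff)+
  have "occ y t0 = 0" "occ y t1 = 0"
    "occ y t \<le> (if \<Delta>1 y = None then 0 else 1)" "occ y te \<le> (if \<Delta>2 y = None then 0 else 1)"
    using T_Rec.prems T_Rec.IH[of y] disjoint_ctxs_at[OF T_Rec.hyps(1), of y] none
      T_Rec.hyps(3-6)[THEN has_type_occ, of y]
    by (auto simp: map_add_Some_iff)
  then show ?case
    using disjoint_ctxs_at[OF T_Rec.hyps(1), of y] by (auto split: if_splits)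
qed auto

section \<open>Shared contexts\<close>

text \<open>Contexts are not split; linearity of higher-order variables is recorded by \<open>occ\<close> at their
  binders instead. The first premise of \<open>S_Lam\<close> is kept because traces pass only values typable in
  the original system.\<close>

inductive styping :: "tctx \<Rightarrow> trm \<Rightarrow> ty \<Rightarrow> bool" where
  S_Var: "\<Gamma> x = Some (a, A) \<Longrightarrow> styping \<Gamma> (Var x) A"
| S_Const: "styping \<Gamma> (Const m) TStr"
| S_Rand: "styping \<Gamma> Rand TStr"
| S_Zero: "styping \<Gamma> t TStr \<Longrightarrow> styping \<Gamma> (Zero t) TStr"
| S_One: "styping \<Gamma> t TStr \<Longrightarrow> styping \<Gamma> (One t) TStr"
| S_Tail: "styping \<Gamma> t TStr \<Longrightarrow> styping \<Gamma> (Tail t) TStr"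
| S_Lam: "\<lbrakk> \<Gamma> \<turnstile> Lam a A t : Arr a A B; styping (ext a A \<Gamma>) t B; A \<noteq> TStr \<Longrightarrow> occ 0 t \<le> 1 \<rbrakk>
         \<Longrightarrow> styping \<Gamma> (Lam a A t) (Arr a A B)"
| S_Sub: "styping \<Gamma> t A \<Longrightarrow> subtype A B \<Longrightarrow> styping \<Gamma> t B"
| S_App: "styping \<Gamma> t (Arr a A B) \<Longrightarrow> styping \<Gamma> s A \<Longrightarrow> styping \<Gamma> (App t s) B"
| S_Case: "\<lbrakk> styping \<Gamma> t TStr; styping \<Gamma> t0 A; styping \<Gamma> t1 A; styping \<Gamma> te A \<rbrakk>
         \<Longrightarrow> styping \<Gamma> (Case A t t0 t1 te) A"
| S_Rec: "\<lbrakk> styping \<Gamma> t TStr; styping \<Gamma> t0 (Arr Box TStr (Arr Black A A));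
           styping \<Gamma> t1 (Arr Box TStr (Arr Black A A)); styping \<Gamma> te A \<rbrakk>
         \<Longrightarrow> styping \<Gamma> (Rec A t t0 t1 te) A"

lemma styping_weakening: "styping \<Gamma> t A \<Longrightarrow> \<Gamma> \<subseteq>\<^sub>m \<Gamma>' \<Longrightarrow> styping \<Gamma>' t A"
proof (induction arbitrary: \<Gamma>' rule: styping.induct)
  case (S_Lam \<Gamma> a A t B)
  then show ?case
    by (blast intro: styping.S_Lam weakening ext_mono)
qed (auto intro: styping.intros simp: map_le_iff, (blast intro: styping.intros)+)

lemma has_type_styping: "\<Gamma> \<turnstile> t : A \<Longrightarrow> styping \<Gamma> t A"
proof (induction rule: has_type.induct)
  case (T_Lam a A \<Gamma> t B)
  then show ?case
    using occ_linear[OF T_Lam.hyps, of 0] by (auto intro: styping.S_Lam has_type.T_Lam)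
next
  case (T_App \<Gamma> \<Delta>1 \<Delta>2 t a A B s)
  then show ?case
    using ctx_submaps_App by (blast intro: styping.S_App styping_weakening)
next
  case (T_Case \<Gamma> \<Delta>1 \<Delta>2 \<Delta>3 \<Delta>4 t t0 A t1 te)
  then show ?case
    using ctx_submaps_Case[OF T_Case.hyps(1)] by (blast intro: styping.S_Case styping_weakening)
next
  case (T_Rec \<Gamma>1 \<Gamma>2 \<Gamma>3 \<Delta>1 \<Delta>2 t t0 A t1 te)
  then show ?case
    using ctx_submaps_Rec[OF T_Rec.hyps(1)] by (blast intro: styping.S_Rec styping_weakening)
qed (auto intro: styping.intros)

section \<open>Outcome probabilities\<close>

definition outcome :: "bits set \<Rightarrow> trm spmf \<Rightarrow> real" where
  "outcome M D = measure (measure_spmf D) (Const ` M)"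

lemma sum_spmf_outcome: "finite M \<Longrightarrow> (\<Sum>m\<in>M. spmf D (Const m)) = outcome M D"
  unfolding outcome_def
  by (subst measure_spmf.finite_measure_eq_sum_singleton)
     (auto simp: sum.reindex inj_on_def spmf_conv_measure_spmf)

lemma outcome_bounds: "0 \<le> outcome M D" "outcome M D \<le> 1"
  unfolding outcome_def by (auto simp: measure_spmf.subprob_measure_le_1)


lemma integrable_bounded_spmf:
  fixes f :: "'a \<Rightarrow> real"
  assumes "\<And>x. \<bar>f x\<bar> \<le> c"
  shows "integrable (measure_spmf p) f"
  using assms by (intro measure_spmf.integrable_const_bound[where B = c]) auto

lemma outcome_bind:
  assumes "finite M"
  shows "outcome M (bind_spmf p F) = (\<integral>x. outcome M (F x) \<partial>measure_spmf p)"
  unfolding sum_spmf_outcome[OF assms, symmetric] spmf_bind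
  by (rule Bochner_Integration.integral_sum[symmetric])
     (auto intro!: integrable_bounded_spmf[where c = 1] simp: pmf_le_1)

lemma integrable_spmf_count_space: "integrable (count_space UNIV) (spmf p)"
  by (rule integrableI_bounded) (simp_all add: nn_integral_spmf measure_spmf.emeasure_eq_measure)

text \<open>The difference of the expectations of \<open>f\<close> is largest for the indicator of the set \<open>P\<close> on
  which \<open>D\<close> exceeds \<open>E\<close>, and \<open>P\<close> is exhausted by finite sets of strings.\<close>

lemma expectation_diff_le:
  fixes f :: "trm \<Rightarrow> real"
  assumes le: "\<And>M. finite M \<Longrightarrow> outcome M D - outcome M E \<le> d"
    and supp: "set_spmf D \<subseteq> range Const"
    and f: "\<And>x. 0 \<le> f x" "\<And>x. f x \<le> 1"
  shows "(\<integral>x. f x \<partial>measure_spmf D) - (\<integral>x. f x \<partial>measure_spmf E) \<le> d"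
proof -
  define P where "P = {x \<in> range Const. spmf D x > spmf E x}"
  define Q where "Q n = {m. length m \<le> n \<and> Const m \<in> P}" for n :: nat
  have int: "integrable (measure_spmf p) f" "integrable (measure_spmf p) (indicator P :: _ \<Rightarrow> real)" for p
    using f by (auto intro!: integrable_bounded_spmf[where c = 1] simp: indicator_def)
  have int': "integrable (count_space UNIV) (\<lambda>x. spmf p x * g x)"
    if "\<And>x. 0 \<le> g x" "\<And>x. g x \<le> (1 :: real)" for p :: "trm spmf" and g
    by (rule Bochner_Integration.integrable_bound[OF integrable_spmf_count_space[of p]])
       (use that in \<open>auto simp: abs_mult mult_left_le\<close>)
  have "(\<integral>x. f x \<partial>measure_spmf D) - (\<integral>x. f x \<partial>measure_spmf E)
      = (\<integral>x. spmf D x * f x - spmf E x * f x \<partial>count_space UNIV)"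
    by (simp add: integral_measure_spmf int int' f)
  also have "\<dots> \<le> (\<integral>x. spmf D x * indicator P x - spmf E x * indicator P x \<partial>count_space UNIV)"
  proof (rule integral_mono)
    fix x
    show "spmf D x * f x - spmf E x * f x \<le> spmf D x * indicator P x - spmf E x * indicator P x"
    proof (cases "x \<in> P")
      case True
      then have "(spmf D x - spmf E x) * f x \<le> (spmf D x - spmf E x) * 1"
        using f by (intro mult_left_mono) (auto simp: P_def)
      then show ?thesis
        using True by (simp add: algebra_simps)
    next
      case False
      \<comment> \<open>If \<open>x\<close> is not a string, \<open>supp\<close> gives
        \<open>spmf D x = 0\<close>; for a string outside \<open>P\<close> the inequality is the
        definition of \<open>P\<close>.\<close>
      then have "spmf D x \<le> spmf E x"
        using supp by (cases "x \<in> set_spmf D") (auto simp: P_def not_less in_set_spmf_iff_spmf)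
      then have "(spmf D x - spmf E x) * f x \<le> 0"
        using f by (intro mult_nonpos_nonneg) auto
      then show ?thesis
        using False by (simp add: algebra_simps)
    qed
  qed (auto intro!: Bochner_Integration.integrable_diff int' f)
  also have "\<dots> = measure (measure_spmf D) P - measure (measure_spmf E) P"
    using integral_measure_spmf[OF int(2), of D] integral_measure_spmf[OF int(2), of E]
    by (subst Bochner_Integration.integral_diff) (auto intro!: int')
  also have "\<dots> \<le> d"
  proof (rule LIMSEQ_le_const2)
    have PQ: "P = (\<Union>n. Const ` Q n)"
      by (auto simp: P_def Q_def)
    have "(\<lambda>n. measure (measure_spmf p) (Const ` Q n)) \<longlonglongrightarrow> measure (measure_spmf p) P" for p
      unfolding PQ by (rule measure_spmf.finite_Lim_measure_incseq) (auto simp: incseq_def Q_def)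
    then show "(\<lambda>n. measure (measure_spmf D) (Const ` Q n) - measure (measure_spmf E) (Const ` Q n))
        \<longlonglongrightarrow> measure (measure_spmf D) P - measure (measure_spmf E) P"
      by (intro tendsto_diff)
    have "finite (Q n)" for n
      by (rule finite_subset[OF _ finite_lists_length_le[of "UNIV :: bool set" n]]) (auto simp: Q_def)
    then show "\<exists>N. \<forall>n\<ge>N. measure (measure_spmf D) (Const ` Q n) - measure (measure_spmf E) (Const ` Q n) \<le> d"
      using le unfolding outcome_def by blast
  qed
  finally show ?thesis .
qed

lemma bind_spmf_const_lossless: "lossless_spmf p \<Longrightarrow> bind_spmf p (\<lambda>_. q) = q"
  by (simp add: bind_spmf_const lossless_weight_spmfD)

section \<open>Evaluation equations\<close>

definition app_val :: "trm \<Rightarrow> trm \<Rightarrow> trm spmf" where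
  "app_val w v = (case w of Lam a A r \<Rightarrow> eval (subst 0 v r) | _ \<Rightarrow> return_pmf None)"

definition str_bind :: "trm spmf \<Rightarrow> (bits \<Rightarrow> trm spmf) \<Rightarrow> trm spmf" where
  "str_bind D f = bind_spmf D (\<lambda>v. case v of Const m \<Rightarrow> f m | _ \<Rightarrow> return_pmf None)"

definition branch :: "bits \<Rightarrow> trm \<Rightarrow> trm \<Rightarrow> trm \<Rightarrow> trm" where
  "branch m t0 t1 te = (case m of [] \<Rightarrow> te | b # n \<Rightarrow> if b then t1 else t0)"

lemma branch_distrib: "f (branch m t0 t1 te) = branch m (f t0) (f t1) (f te)"
  by (simp add: branch_def split: list.split)

lemma branch_cases: "P t0 \<Longrightarrow> P t1 \<Longrightarrow> P te \<Longrightarrow> P (branch m t0 t1 te)"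
  by (simp add: branch_def split: list.split)

lemma pass_eq: "pass v D = bind_spmf D (\<lambda>w. app_val w v)"
  by (simp add: pass_def app_val_def)

lemma eval_Const [simp]: "eval (Const m) = return_spmf (Const m)"
  by (subst eval.simps) simp

lemma eval_Lam [simp]: "eval (Lam a A r) = return_spmf (Lam a A r)"
  by (subst eval.simps) simp

lemma eval_value: "is_value v \<Longrightarrow> eval v = return_spmf v"
  by (cases v) simp_all

lemma eval_Zero: "eval (Zero s) = str_bind (eval s) (\<lambda>m. return_spmf (Const (False # m)))"
  unfolding str_bind_def by (subst eval.simps) simp

lemma eval_One: "eval (One s) = str_bind (eval s) (\<lambda>m. return_spmf (Const (True # m)))"
  unfolding str_bind_def by (subst eval.simps) simp

lemma eval_Tail: "eval (Tail s) = str_bind (eval s) (\<lambda>m. return_spmf (Const (tl m)))"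
  unfolding str_bind_def by (subst eval.simps) simp

lemma eval_Rand: "eval Rand = map_spmf (\<lambda>b. Const [b]) coin_spmf"
  by (subst eval.simps) simp

lemma eval_App: "eval (App f s) = bind_spmf (eval f) (\<lambda>w. bind_spmf (eval s) (app_val w))"
  unfolding app_val_def by (subst eval.simps) simp

lemma eval_Case: "eval (Case A s t0 t1 te) = str_bind (eval s) (\<lambda>m. eval (branch m t0 t1 te))"
  unfolding str_bind_def branch_def
  by (subst eval.simps) (auto intro!: bind_spmf_cong split: trm.split list.split)

lemma eval_Rec_Nil: "eval (Rec A (Const []) t0 t1 te) = eval te"
  by (subst eval.simps) simp

lemma eval_Rec_Cons: "eval (Rec A (Const (b # n)) t0 t1 te) =
    eval (App (App (if b then t1 else t0) (Const (b # n))) (Rec A (Const n) t0 t1 te))"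
  by (subst eval.simps) simp

text \<open>Separates evaluating the scrutinee from unfolding the recursion, so that the latter can
  be treated by induction on a string constant.\<close>

lemma eval_Rec: "eval (Rec A s t0 t1 te) = str_bind (eval s) (\<lambda>m. eval (Rec A (Const m) t0 t1 te))"
proof -
  have "eval (Rec A s t0 t1 te) = str_bind (eval s) (\<lambda>m. case m of
      [] \<Rightarrow> eval te
    | b # n \<Rightarrow> eval (App (App (if b then t1 else t0) (Const (b # n))) (Rec A (Const n) t0 t1 te)))"
    unfolding str_bind_def by (subst eval.simps) simp
  also have "\<dots> = str_bind (eval s) (\<lambda>m. eval (Rec A (Const m) t0 t1 te))"
    by (rule arg_cong[where f = "str_bind _"])
       (simp add: fun_eq_iff eval_Rec_Nil eval_Rec_Cons split: list.split)
  finally show ?thesis .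
qed


section \<open>The logical relation\<close>

text \<open>\<open>close d A D E\<close> bounds by \<open>d\<close> the trace distance of value distributions, but over traces
  passing good values; a value is \<open>good\<close> if it terminates on good arguments with good results and,
  as a consumer of a single argument, is nonexpansive for \<open>close d\<close>. Once all typable terms are
  known to be good, the difference between the two kinds of traces disappears.\<close>

fun good :: "real \<Rightarrow> ty \<Rightarrow> trm \<Rightarrow> bool"
  and close :: "real \<Rightarrow> ty \<Rightarrow> trm spmf \<Rightarrow> trm spmf \<Rightarrow> bool" where
  "good d TStr v \<longleftrightarrow> (\<exists>m. v = Const m)"
| "good d (Arr a A B) v \<longleftrightarrow> is_value v \<and> has_type Map.empty v (Arr a A B)
     \<and> (\<forall>u. good d A u \<longrightarrow>
          lossless_spmf (app_val v u) \<and> (\<forall>w \<in> set_spmf (app_val v u). good d B w))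
     \<and> (\<forall>D E. lossless_spmf D \<and> lossless_spmf E \<and> (\<forall>u \<in> set_spmf D \<union> set_spmf E. good d A u)
          \<and> close d A D E \<longrightarrow> close d B (bind_spmf D (app_val v)) (bind_spmf E (app_val v)))"
| "close d TStr D E \<longleftrightarrow> (\<forall>M. finite M \<longrightarrow> \<bar>outcome M D - outcome M E\<bar> \<le> d)"
| "close d (Arr a A B) D E \<longleftrightarrow> (\<forall>u. good d A u \<longrightarrow> close d B (pass u D) (pass u E))"

definition good_term :: "real \<Rightarrow> ty \<Rightarrow> trm \<Rightarrow> bool" where
  "good_term d A t \<longleftrightarrow> lossless_spmf (eval t) \<and> (\<forall>v \<in> set_spmf (eval t). good d A v)"

lemma good_typed: "good d A v \<Longrightarrow> is_value v \<and> has_type Map.empty v A"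
  by (cases A) (auto intro: has_type.intros)

lemma good_imp_good_term: "good d A v \<Longrightarrow> good_term d A v"
  by (simp add: good_term_def eval_value good_typed)

lemma good_term_value: "good_term d A v \<Longrightarrow> is_value v \<Longrightarrow> good d A v"
  by (simp add: good_term_def eval_value)

section \<open>Closeness under mixtures and kernels\<close>

lemma close_refl: "0 \<le> d \<Longrightarrow> close d A D D"
  by (induction A arbitrary: D) auto

text \<open>Convexity of the trace distance: every test is affine in the tested distribution, and
  \<open>pass\<close> moves inside the mixture. Mass missing from \<open>p\<close> only lowers the
  bound, as \<open>0 \<le> d\<close>.\<close>

lemma close_bind:
  assumes "0 \<le> d" and "\<And>x. x \<in> set_spmf p \<Longrightarrow> close d A (F x) (G x)"
  shows "close d A (bind_spmf p F) (bind_spmf p G)"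
  using assms(2)
proof (induction A arbitrary: F G)
  case TStr
  have "\<bar>outcome M (bind_spmf p F) - outcome M (bind_spmf p G)\<bar> \<le> d" if M: "finite M" for M
  proof -
    have int: "integrable (measure_spmf p) (\<lambda>x. outcome M (H x))" for H
      using outcome_bounds by (intro integrable_bounded_spmf[where c = 1]) auto
    have "\<bar>outcome M (bind_spmf p F) - outcome M (bind_spmf p G)\<bar>
        = \<bar>\<integral>x. outcome M (F x) - outcome M (G x) \<partial>measure_spmf p\<bar>"
      by (simp add: outcome_bind M int)
    also have "\<dots> \<le> (\<integral>x. \<bar>outcome M (F x) - outcome M (G x)\<bar> \<partial>measure_spmf p)"
      by (rule integral_abs_bound)
    also have "\<dots> \<le> (\<integral>x. d \<partial>measure_spmf p)"
      using TStr M by (intro integral_mono_AE) (auto intro!: integrable_abs Bochner_Integration.integrable_diff int)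
    also have "\<dots> \<le> d"
      using assms(1) by (simp add: measure_spmf.subprob_measure_le_1 mult_left_le_one_le)
    finally show ?thesis .
  qed
  then show ?case
    by simp
next
  case (Arr a A B)
  then show ?case
    by (simp add: pass_eq)
qed

text \<open>Testing the output of \<open>K\<close> is integrating a function with values in [0,1]
  over the input strings, so \<open>expectation_diff_le\<close> applies in both directions. At arrow
  types \<open>pass\<close> is absorbed into \<open>K\<close>, which is why \<open>K\<close> is
  arbitrary.\<close>

lemma close_str_kernel:
  assumes "close d TStr D E" and "\<And>v. v \<in> set_spmf D \<union> set_spmf E \<Longrightarrow> good d TStr v"
  shows "close d A (bind_spmf D K) (bind_spmf E K)"
proof (induction A arbitrary: K)
  case TStr
  have "\<bar>outcome M (bind_spmf D K) - outcome M (bind_spmf E K)\<bar> \<le> d" if M: "finite M" for M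
    using expectation_diff_le[of D E d "\<lambda>x. outcome M (K x)"]
      expectation_diff_le[of E D d "\<lambda>x. outcome M (K x)"] assms
    by (fastforce simp: outcome_bind M outcome_bounds abs_le_iff)
  then show ?case
    by simp
next
  case (Arr a A B)
  then show ?case
    by (simp add: pass_eq)
qed

lemma close_str_bind:
  assumes "close d TStr D E" and "\<And>v. v \<in> set_spmf D \<union> set_spmf E \<Longrightarrow> good d TStr v"
  shows "close d A (str_bind D f) (str_bind E f)"
  unfolding str_bind_def using assms by (rule close_str_kernel)

text \<open>The two parts need each other: \<open>close\<close> at an arrow type quantifies over
  good arguments and \<open>good\<close> over close distributions, so contravariance in the domain
  uses both.\<close>

lemma good_close_subtype:
  "subtype A B \<Longrightarrow>
    (\<forall>v. good d A v \<longrightarrow> good d B v) \<and> (\<forall>D E. close d A D E \<longrightarrow> close d B D E)"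
proof (induction rule: subtype.induct)
  case (sub_arr B A C D a b)
  have "has_type Map.empty v (Arr b B D)" if "has_type Map.empty v (Arr a A C)" for v
    using that sub_arr.hyps by (blast intro: has_type.T_Sub subtype.sub_arr)
  then show ?case
    using sub_arr.IH by (auto; blast)
qed auto

lemma good_term_subtype: "good_term d A t \<Longrightarrow> subtype A B \<Longrightarrow> good_term d B t"
  using good_close_subtype unfolding good_term_def by blast

lemma good_term_str_bind:
  assumes "good_term d TStr s" and "eval t = str_bind (eval s) f"
    and "\<And>m. lossless_spmf (f m) \<and> (\<forall>v \<in> set_spmf (f m). good d A v)"
  shows "good_term d A t"
  using assms unfolding good_term_def str_bind_def by (fastforce simp: set_bind_spmf)

lemma good_term_App:
  assumes "good_term d (Arr a A B) f" and "good_term d A s"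
  shows "good_term d B (App f s)"
  using assms unfolding good_term_def by (auto simp: eval_App set_bind_spmf) blast

text \<open>Each unfolding drops one bit of the string and hands the remaining recursion on as an
  ordinary argument, so induction on the string gives termination.\<close>

lemma good_term_Rec_Const:
  assumes "good_term d (Arr a TStr (Arr b A A)) t0" "good_term d (Arr a TStr (Arr b A A)) t1"
    and "good_term d A te"
  shows "good_term d A (Rec A' (Const m) t0 t1 te)"
proof (induction m)
  case Nil
  then show ?case
    using assms(3) by (simp add: good_term_def eval_Rec_Nil)
next
  case (Cons x m)
  have "good_term d (Arr a TStr (Arr b A A)) (if x then t1 else t0)"
    using assms by simp
  then have "good_term d (Arr b A A) (App (if x then t1 else t0) (Const (x # m)))"
    by (rule good_term_App) (simp add: good_imp_good_term)
  then have "good_term d A (App (App (if x then t1 else t0) (Const (x # m))) (Rec A' (Const m) t0 t1 te))"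
    using Cons by (rule good_term_App)
  then show ?case
    unfolding good_term_def eval_Rec_Cons .
qed

text \<open>Function and argument are evaluated independently, so the argument can be sampled first;
  what remains is a mixture of passes of good values.\<close>

lemma close_App_left:
  assumes d: "0 \<le> d" and "close d (Arr a A B) (bind_spmf D (\<lambda>x. eval (F x))) (bind_spmf E (\<lambda>x. eval (F x)))"
    and "good_term d A s"
  shows "close d B (bind_spmf D (\<lambda>x. eval (App (F x) s))) (bind_spmf E (\<lambda>x. eval (App (F x) s)))"
proof -
  have "bind_spmf D (\<lambda>x. eval (App (F x) s)) = bind_spmf (eval s) (\<lambda>v. pass v (bind_spmf D (\<lambda>x. eval (F x))))" for D
    unfolding eval_App pass_eq bind_spmf_assoc
    by (subst bind_commute_spmf, subst (2) bind_commute_spmf) (rule refl)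
  then show ?thesis
    using assms by (auto intro!: close_bind simp: good_term_def)
qed

text \<open>The fixed function is evaluated first. Each of its values is good, and its
  nonexpansiveness clause applies to the argument values, whose distribution is lossless because all
  \<open>F x\<close> terminate.\<close>

lemma close_App_right:
  assumes d: "0 \<le> d" and "close d A (bind_spmf D (\<lambda>x. eval (F x))) (bind_spmf E (\<lambda>x. eval (F x)))"
    and "lossless_spmf D" "lossless_spmf E"
    and "\<And>x. x \<in> set_spmf D \<union> set_spmf E \<Longrightarrow> good_term d A (F x)"
    and f: "good_term d (Arr a A B) f"
  shows "close d B (bind_spmf D (\<lambda>x. eval (App f (F x)))) (bind_spmf E (\<lambda>x. eval (App f (F x))))"
proof -
  have eq: "bind_spmf D (\<lambda>x. eval (App f (F x)))
      = bind_spmf (eval f) (\<lambda>w. bind_spmf (bind_spmf D (\<lambda>x. eval (F x))) (app_val w))" for D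
    unfolding eval_App bind_spmf_assoc by (rule bind_commute_spmf)
  have "close d B (bind_spmf (bind_spmf D (\<lambda>x. eval (F x))) (app_val w))
      (bind_spmf (bind_spmf E (\<lambda>x. eval (F x))) (app_val w))" if "w \<in> set_spmf (eval f)" for w
  proof -
    have "good d (Arr a A B) w"
      using that f by (simp add: good_term_def)
    moreover have "\<forall>u \<in> set_spmf (bind_spmf D (\<lambda>x. eval (F x))) \<union> set_spmf (bind_spmf E (\<lambda>x. eval (F x))). good d A u"
      using assms(5) by (auto simp: good_term_def set_bind_spmf) blast+
    moreover have "lossless_spmf (bind_spmf D (\<lambda>x. eval (F x)))" "lossless_spmf (bind_spmf E (\<lambda>x. eval (F x)))"
      using assms(3-5) by (auto simp: good_term_def)
    ultimately show ?thesis
      using assms(2) unfolding good.simps by blast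
  qed
  then show ?thesis
    unfolding eq using d by (intro close_bind)
qed

section \<open>The fundamental lemma\<close>

text \<open>Closedness is demanded at undeclared indices too, since \<open>subst_csub\<close> needs
  it everywhere. Entries may be unevaluated terms.\<close>

definition good_sub :: "real \<Rightarrow> tctx \<Rightarrow> (nat \<Rightarrow> trm) \<Rightarrow> bool" where
  "good_sub d \<Gamma> \<sigma> \<longleftrightarrow> (\<forall>n. scoped 0 (\<sigma> n))
     \<and> (\<forall>n a A. \<Gamma> n = Some (a, A) \<longrightarrow> has_type Map.empty (\<sigma> n) A \<and> good_term d A (\<sigma> n))"

definition good_dist :: "real \<Rightarrow> ty \<Rightarrow> trm spmf \<Rightarrow> bool" where
  "good_dist d A D \<longleftrightarrow>
     lossless_spmf D \<and> (\<forall>s \<in> set_spmf D. has_type Map.empty s A \<and> good_term d A s)"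

text \<open>Samples are unevaluated terms, as a hole receives them. Hence
  \<open>occ y t \<le> 1\<close> is required even at \<open>TStr\<close>: \<open>Rand\<close> and a
  fair mixture of its two outcomes have trace distance 0, but evaluating one sample twice separates
  them.\<close>

definition linear_nonexpansive :: "real \<Rightarrow> tctx \<Rightarrow> trm \<Rightarrow> ty \<Rightarrow> bool" where
  "linear_nonexpansive d \<Gamma> t B \<longleftrightarrow> (\<forall>\<sigma> y a A D E.
     good_sub d \<Gamma> \<sigma> \<and> \<Gamma> y = Some (a, A) \<and> occ y t \<le> 1 \<and> good_dist d A D \<and> good_dist d A E
       \<and> close d A (bind_spmf D eval) (bind_spmf E eval) \<longrightarrow>
     close d B (bind_spmf D (\<lambda>s. eval (csub 0 (\<sigma>(y := s)) t)))
               (bind_spmf E (\<lambda>s. eval (csub 0 (\<sigma>(y := s)) t))))"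

lemma closed_scoped: "has_type Map.empty t A \<Longrightarrow> scoped 0 t"
  by (rule has_type_scoped) auto

lemma bind_eval_good:
  assumes "\<And>u. u \<in> set_spmf D \<Longrightarrow> good d A u"
  shows "bind_spmf D eval = D"
proof -
  have "bind_spmf D eval = bind_spmf D return_spmf"
    using assms by (intro bind_spmf_cong refl eval_value) (blast dest: good_typed)
  then show ?thesis
    by simp
qed

lemma good_sub_upd:
  assumes "good_sub d \<Gamma> \<sigma>" and "\<Gamma> y = Some (a, A)" and "has_type Map.empty s A" and "good_term d A s"
  shows "good_sub d \<Gamma> (\<sigma>(y := s))"
  using assms closed_scoped unfolding good_sub_def by auto

lemma good_sub_ext:
  assumes "good_sub d \<Gamma> \<sigma>" and "good d A u"
  shows "good_sub d (ext a A \<Gamma>) (case_nat u \<sigma>)"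
  using assms good_typed[OF assms(2)] good_imp_good_term[OF assms(2)] closed_scoped
  unfolding good_sub_def ext_def by (auto split: nat.splits)

lemma eval_subst_csub:
  assumes "good_sub d \<Gamma> \<sigma>"
  shows "app_val (Lam a A (csub (Suc 0) \<sigma> t)) u = eval (csub 0 (case_nat u \<sigma>) t)"
  using assms subst_csub[of \<sigma> 0 u t] by (simp add: app_val_def good_sub_def)

text \<open>If \<open>y\<close> does not occur, the sample is discarded, and both sides are the same
  distribution because \<open>D\<close> and \<open>E\<close> are lossless; so exactly one occurrence
  may be assumed.\<close>

lemma linear_nonexpansiveI:
  assumes d: "0 \<le> d"
    and "\<And>\<sigma> y a A D E. \<lbrakk> good_sub d \<Gamma> \<sigma>; \<Gamma> y = Some (a, A); occ y t = 1; good_dist d A D; good_dist d A E;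
        close d A (bind_spmf D eval) (bind_spmf E eval) \<rbrakk> \<Longrightarrow>
      close d B (bind_spmf D (\<lambda>s. eval (csub 0 (\<sigma>(y := s)) t)))
                (bind_spmf E (\<lambda>s. eval (csub 0 (\<sigma>(y := s)) t)))"
  shows "linear_nonexpansive d \<Gamma> t B"
  unfolding linear_nonexpansive_def
proof (intro allI impI, elim conjE)
  fix \<sigma> y a A D E
  assume *: "good_sub d \<Gamma> \<sigma>" "\<Gamma> y = Some (a, A)" "occ y t \<le> 1" "good_dist d A D" "good_dist d A E"
    "close d A (bind_spmf D eval) (bind_spmf E eval)"
  show "close d B (bind_spmf D (\<lambda>s. eval (csub 0 (\<sigma>(y := s)) t)))
                  (bind_spmf E (\<lambda>s. eval (csub 0 (\<sigma>(y := s)) t)))"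
  proof (cases "occ y t = 0")
    case True
    then have "csub 0 (\<sigma>(y := s)) t = csub 0 \<sigma> t" for s
      using csub_upd_occ[of y 0 t \<sigma> s "\<sigma> y"] by simp
    then show ?thesis
      using *(4,5) d by (simp add: good_dist_def bind_spmf_const_lossless close_refl)
  next
    case False
    then show ?thesis
      using * by (intro assms(2)) auto
  qed
qed

lemma linear_nonexpansiveD:
  "\<lbrakk> linear_nonexpansive d \<Gamma> t B; good_sub d \<Gamma> \<sigma>; \<Gamma> y = Some (a, A); occ y t \<le> 1; good_dist d A D; good_dist d A E;
     close d A (bind_spmf D eval) (bind_spmf E eval) \<rbrakk> \<Longrightarrow>
   close d B (bind_spmf D (\<lambda>s. eval (csub 0 (\<sigma>(y := s)) t)))
             (bind_spmf E (\<lambda>s. eval (csub 0 (\<sigma>(y := s)) t)))"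
  unfolding linear_nonexpansive_def by blast

lemma bind_str_bind: "bind_spmf D (\<lambda>s. str_bind (F s) K) = str_bind (bind_spmf D F) K"
  by (simp add: str_bind_def)

lemma bind_str_bind_const:
  "bind_spmf D (\<lambda>s. str_bind p (K s)) = str_bind p (\<lambda>m. bind_spmf D (\<lambda>s. K s m))"
  unfolding str_bind_def
  by (subst bind_commute_spmf) (auto intro!: bind_spmf_cong split: trm.split)

lemma close_str_bind_right:
  assumes "0 \<le> d" and "\<And>m. close d A (F m) (G m)"
  shows "close d A (str_bind p F) (str_bind p G)"
  unfolding str_bind_def using assms
  by (intro close_bind) (auto intro: close_refl split: trm.split)

text \<open>If the linear variable occurs in the scrutinee, the rest is a fixed kernel applied to a
  distribution on strings.\<close>

lemma close_scrutinee:
  assumes "close d TStr (bind_spmf D (\<lambda>s. eval (F s))) (bind_spmf E (\<lambda>s. eval (F s)))"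
    and "\<And>s. s \<in> set_spmf D \<union> set_spmf E \<Longrightarrow> good_term d TStr (F s)"
  shows "close d A (bind_spmf D (\<lambda>s. str_bind (eval (F s)) K)) (bind_spmf E (\<lambda>s. str_bind (eval (F s)) K))"
  unfolding bind_str_bind
  by (rule close_str_bind[OF assms(1)]) (use assms(2) in \<open>auto simp: good_term_def set_bind_spmf\<close>)

text \<open>A perturbed base term passes through one application per bit, each with a fixed good
  function; these do not expand the distance, so \<open>d\<close> does not grow with the length of
  the string.\<close>

lemma close_Rec_Const:
  assumes d: "0 \<le> d"
    and "good_term d (Arr a TStr (Arr b A A)) t0" "good_term d (Arr a TStr (Arr b A A)) t1"
    and te: "\<And>x. x \<in> set_spmf D \<union> set_spmf E \<Longrightarrow> good_term d A (F x)"
    and ll: "lossless_spmf D" "lossless_spmf E"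
    and cl: "close d A (bind_spmf D (\<lambda>x. eval (F x))) (bind_spmf E (\<lambda>x. eval (F x)))"
  shows "close d A (bind_spmf D (\<lambda>x. eval (Rec A' (Const m) t0 t1 (F x))))
                   (bind_spmf E (\<lambda>x. eval (Rec A' (Const m) t0 t1 (F x))))"
proof (induction m)
  case Nil
  then show ?case
    using cl by (simp add: eval_Rec_Nil)
next
  case (Cons x m)
  have "good_term d (Arr a TStr (Arr b A A)) (if x then t1 else t0)"
    using assms by simp
  then have "good_term d (Arr b A A) (App (if x then t1 else t0) (Const (x # m)))"
    by (rule good_term_App) (simp add: good_imp_good_term)
  then show ?case
    unfolding eval_Rec_Cons using Cons d ll assms(2,3) te
    by (intro close_App_right) (auto intro: good_term_Rec_Const)
qed

definition sound :: "real \<Rightarrow> tctx \<Rightarrow> trm \<Rightarrow> ty \<Rightarrow> bool" where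
  "sound d \<Gamma> t B \<longleftrightarrow>
     (\<forall>\<sigma>. good_sub d \<Gamma> \<sigma> \<longrightarrow> good_term d B (csub 0 \<sigma> t)) \<and> linear_nonexpansive d \<Gamma> t B"

text \<open>Packages the induction step: for the same \<open>\<sigma>\<close>, \<open>y\<close>,
  \<open>D\<close> and \<open>E\<close>, updated substitutions stay good and every sound term that
  uses \<open>y\<close> linearly yields close results.\<close>

lemma soundI:
  assumes "0 \<le> d" and "\<And>\<sigma>. good_sub d \<Gamma> \<sigma> \<Longrightarrow> good_term d B (csub 0 \<sigma> t)"
    and "\<And>\<sigma> y a A D E. \<lbrakk> good_sub d \<Gamma> \<sigma>; \<Gamma> y = Some (a, A); occ y t = 1; good_dist d A D; good_dist d A E;
        close d A (bind_spmf D eval) (bind_spmf E eval);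
        \<And>s. s \<in> set_spmf D \<union> set_spmf E \<Longrightarrow> good_sub d \<Gamma> (\<sigma>(y := s));
        \<And>u C. sound d \<Gamma> u C \<Longrightarrow> occ y u \<le> 1 \<Longrightarrow>
          close d C (bind_spmf D (\<lambda>s. eval (csub 0 (\<sigma>(y := s)) u)))
                    (bind_spmf E (\<lambda>s. eval (csub 0 (\<sigma>(y := s)) u))) \<rbrakk> \<Longrightarrow>
      close d B (bind_spmf D (\<lambda>s. eval (csub 0 (\<sigma>(y := s)) t)))
                (bind_spmf E (\<lambda>s. eval (csub 0 (\<sigma>(y := s)) t)))"
  shows "sound d \<Gamma> t B"
  unfolding sound_def
proof (intro conjI allI impI linear_nonexpansiveI[OF assms(1)])
  fix \<sigma> y a A D E
  assume *: "good_sub d \<Gamma> \<sigma>" "\<Gamma> y = Some (a, A)" "occ y t = 1" "good_dist d A D" "good_dist d A E"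
    "close d A (bind_spmf D eval) (bind_spmf E eval)"
  show "close d B (bind_spmf D (\<lambda>s. eval (csub 0 (\<sigma>(y := s)) t)))
                  (bind_spmf E (\<lambda>s. eval (csub 0 (\<sigma>(y := s)) t)))"
  proof (rule assms(3)[OF *])
    show "good_sub d \<Gamma> (\<sigma>(y := s))" if "s \<in> set_spmf D \<union> set_spmf E" for s
      using that good_sub_upd[OF *(1,2)] *(4,5) by (auto simp: good_dist_def)
    show "close d C (bind_spmf D (\<lambda>s. eval (csub 0 (\<sigma>(y := s)) u)))
                    (bind_spmf E (\<lambda>s. eval (csub 0 (\<sigma>(y := s)) u)))"
      if "sound d \<Gamma> u C" "occ y u \<le> 1" for u C
      using that * unfolding sound_def by (blast intro: linear_nonexpansiveD)
  qed
qed (rule assms(2))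

lemma sound_good: "sound d \<Gamma> t B \<Longrightarrow> good_sub d \<Gamma> \<sigma> \<Longrightarrow> good_term d B (csub 0 \<sigma> t)"
  by (simp add: sound_def)

lemma sound_str_op:
  assumes d: "0 \<le> d" and t: "sound d \<Gamma> t TStr" and occ: "\<And>y. occ y u = occ y t"
    and eval: "\<And>\<sigma>. eval (csub 0 \<sigma> u) = str_bind (eval (csub 0 \<sigma> t)) (\<lambda>m. return_spmf (Const (f m)))"
  shows "sound d \<Gamma> u TStr"
proof (rule soundI[OF d])
  show "good_term d TStr (csub 0 \<sigma> u)" if "good_sub d \<Gamma> \<sigma>" for \<sigma>
    using sound_good[OF t that] eval by (rule good_term_str_bind) simp
next
  fix \<sigma> y D E
  assume "occ y u = 1" and upd: "\<And>s. s \<in> set_spmf D \<union> set_spmf E \<Longrightarrow> good_sub d \<Gamma> (\<sigma>(y := s))"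
    and cl: "\<And>u C. sound d \<Gamma> u C \<Longrightarrow> occ y u \<le> 1 \<Longrightarrow>
      close d C (bind_spmf D (\<lambda>s. eval (csub 0 (\<sigma>(y := s)) u))) (bind_spmf E (\<lambda>s. eval (csub 0 (\<sigma>(y := s)) u)))"
  then show "close d TStr (bind_spmf D (\<lambda>s. eval (csub 0 (\<sigma>(y := s)) u))) (bind_spmf E (\<lambda>s. eval (csub 0 (\<sigma>(y := s)) u)))"
    unfolding eval using occ sound_good[OF t] by (intro close_scrutinee cl t) auto
qed

text \<open>Goodness and nonexpansiveness go through one induction: an abstraction is good only if
  its body is nonexpansive in the bound variable, and an application with the linear variable in its
  argument is nonexpansive only if the function is good.\<close>

lemma fundamental:
  assumes d: "0 \<le> d"
  shows "styping \<Gamma> t B \<Longrightarrow> sound d \<Gamma> t B"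
proof (induction rule: styping.induct)
  case (S_Var \<Gamma> x a A)
  show ?case
  proof (rule soundI[OF d])
    show "good_term d A (csub 0 \<sigma> (Var x))" if "good_sub d \<Gamma> \<sigma>" for \<sigma>
      using that S_Var unfolding good_sub_def by auto
  next
    fix \<sigma> y b C D E
    assume "\<Gamma> y = Some (b, C)" "occ y (Var x) = 1" "close d C (bind_spmf D eval) (bind_spmf E eval)"
    then show "close d A (bind_spmf D (\<lambda>s. eval (csub 0 (\<sigma>(y := s)) (Var x))))
        (bind_spmf E (\<lambda>s. eval (csub 0 (\<sigma>(y := s)) (Var x))))"
      using S_Var by (simp split: if_splits)
  qed
next
  case (S_Const \<Gamma> m)
  show ?case
    by (rule soundI[OF d]) (simp add: good_imp_good_term, simp only: occ.simps zero_neq_one)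
next
  case (S_Rand \<Gamma>)
  show ?case
    by (rule soundI[OF d]) ((auto simp: good_term_def eval_Rand)[1], simp only: occ.simps zero_neq_one)
next
  case (S_Zero \<Gamma> t)
  show ?case
    by (rule sound_str_op[OF d S_Zero.IH]) (simp_all add: eval_Zero)
next
  case (S_One \<Gamma> t)
  show ?case
    by (rule sound_str_op[OF d S_One.IH]) (simp_all add: eval_One)
next
  case (S_Tail \<Gamma> t)
  show ?case
    by (rule sound_str_op[OF d S_Tail.IH]) (simp_all add: eval_Tail)
next
  case (S_Lam \<Gamma> a A t B)
  note body = sound_good[OF S_Lam.IH] and body_nonexp = conjunct2[OF S_Lam.IH[unfolded sound_def]]
  show ?case
  proof (rule soundI[OF d])
    fix \<sigma>
    assume \<sigma>: "good_sub d \<Gamma> \<sigma>"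
    let ?v = "Lam a A (csub (Suc 0) \<sigma> t)"
    have app: "app_val ?v = (\<lambda>u. eval (csub 0 (case_nat u \<sigma>) t))"
      using eval_subst_csub[OF \<sigma>] by blast
    have typed: "has_type Map.empty ?v (Arr a A B)"
      using csub_typing_closed[OF S_Lam.hyps(1), of \<sigma>] \<sigma> by (auto simp: good_sub_def)
    have "close d B (bind_spmf D (app_val ?v)) (bind_spmf E (app_val ?v))"
      if DE: "lossless_spmf D" "lossless_spmf E" "\<forall>u \<in> set_spmf D \<union> set_spmf E. good d A u" "close d A D E" for D E
    proof (cases "A = TStr")
      \<comment> \<open>The bound variable may occur often, but its instances are string constants,
        so the body acts as a kernel.\<close>
      case True
      then show ?thesis
        using DE by (intro close_str_kernel) auto
    next
      case False
      \<comment> \<open>Any good value will do: it only makes \<open>case_nat u \<sigma>\<close> a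
        good substitution, and its entry 0 is overwritten by the samples.\<close>
      obtain u where u: "u \<in> set_spmf D"
        using DE(1) measure_spmf_zero_iff[of D UNIV] by (auto simp: lossless_spmf_def weight_spmf_def)
      have upd: "(case_nat u \<sigma>)(0 := s) = case_nat s \<sigma>" for s
        by (auto simp: fun_eq_iff split: nat.split)
      have "close d A (bind_spmf D eval) (bind_spmf E eval)"
        using DE bind_eval_good[of D d A] bind_eval_good[of E d A] by auto
      moreover have "good_dist d A D" "good_dist d A E"
        using DE good_typed good_imp_good_term unfolding good_dist_def by blast+
      moreover have "good_sub d (ext a A \<Gamma>) (case_nat u \<sigma>)"
        using DE(3) u by (intro good_sub_ext[OF \<sigma>]) auto
      ultimately have "close d B (bind_spmf D (\<lambda>s. eval (csub 0 ((case_nat u \<sigma>)(0 := s)) t)))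
          (bind_spmf E (\<lambda>s. eval (csub 0 ((case_nat u \<sigma>)(0 := s)) t)))"
        using S_Lam.hyps(3)[OF False] by (intro linear_nonexpansiveD[OF body_nonexp]) simp_all
      then show ?thesis
        unfolding app upd .
    qed
    moreover have "lossless_spmf (app_val ?v u) \<and> (\<forall>w \<in> set_spmf (app_val ?v u). good d B w)" if "good d A u" for u
      using body[OF good_sub_ext[OF \<sigma> that]] unfolding app good_term_def .
    ultimately have "good d (Arr a A B) ?v"
      using typed by auto
    then show "good_term d (Arr a A B) (csub 0 \<sigma> (Lam a A t))"
      by (simp add: good_imp_good_term)
  next
    fix \<sigma> y b C D E
    assume *: "good_sub d \<Gamma> \<sigma>" "\<Gamma> y = Some (b, C)" "occ y (Lam a A t) = 1" "good_dist d C D" "good_dist d C E"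
      "close d C (bind_spmf D eval) (bind_spmf E eval)"
    have "close d B (pass u (bind_spmf D (\<lambda>s. eval (csub 0 (\<sigma>(y := s)) (Lam a A t)))))
        (pass u (bind_spmf E (\<lambda>s. eval (csub 0 (\<sigma>(y := s)) (Lam a A t)))))" if u: "good d A u" for u
    proof -
      \<comment> \<open>Passing \<open>u\<close> opens the body: \<open>u\<close> takes index 0 and
        the linear variable moves to \<open>Suc y\<close>, as in the clause of \<open>occ\<close>
        for abstractions.\<close>
      have upd: "case_nat u (\<sigma>(y := s)) = (case_nat u \<sigma>)(Suc y := s)" for s
        by (auto simp: fun_eq_iff split: nat.split)
      have eq: "pass u (bind_spmf D' (\<lambda>s. eval (csub 0 (\<sigma>(y := s)) (Lam a A t))))
          = bind_spmf D' (\<lambda>s. eval (csub 0 ((case_nat u \<sigma>)(Suc y := s)) t))" if "good_dist d C D'" for D'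
        unfolding pass_eq bind_spmf_assoc
        by (rule bind_spmf_cong)
           (use that eval_subst_csub[OF good_sub_upd[OF *(1,2)]] in \<open>auto simp: good_dist_def upd\<close>)
      show ?thesis
        unfolding eq[OF *(4)] eq[OF *(5)] using *
        by (intro linear_nonexpansiveD[OF body_nonexp good_sub_ext[OF *(1) u]]) auto
    qed
    then show "close d (Arr a A B) (bind_spmf D (\<lambda>s. eval (csub 0 (\<sigma>(y := s)) (Lam a A t))))
        (bind_spmf E (\<lambda>s. eval (csub 0 (\<sigma>(y := s)) (Lam a A t))))"
      by simp
  qed
next
  case (S_Sub \<Gamma> t A B)
  then show ?case
    using good_term_subtype good_close_subtype unfolding sound_def linear_nonexpansive_def by blast
next
  case (S_App \<Gamma> t a A B s)
  show ?case
  proof (rule soundI[OF d])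
    fix \<sigma>
    assume "good_sub d \<Gamma> \<sigma>"
    then show "good_term d B (csub 0 \<sigma> (App t s))"
      using S_App.IH by (auto intro: good_term_App sound_good)
  next
    fix \<sigma> y b C D E
    assume *: "good_sub d \<Gamma> \<sigma>" "\<Gamma> y = Some (b, C)" "occ y (App t s) = 1" "good_dist d C D" "good_dist d C E"
      "close d C (bind_spmf D eval) (bind_spmf E eval)"
    assume upd: "\<And>s. s \<in> set_spmf D \<union> set_spmf E \<Longrightarrow> good_sub d \<Gamma> (\<sigma>(y := s))"
      and cl: "\<And>u C. sound d \<Gamma> u C \<Longrightarrow> occ y u \<le> 1 \<Longrightarrow>
        close d C (bind_spmf D (\<lambda>s. eval (csub 0 (\<sigma>(y := s)) u))) (bind_spmf E (\<lambda>s. eval (csub 0 (\<sigma>(y := s)) u)))"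
    show "close d B (bind_spmf D (\<lambda>x. eval (csub 0 (\<sigma>(y := x)) (App t s))))
        (bind_spmf E (\<lambda>x. eval (csub 0 (\<sigma>(y := x)) (App t s))))"
    \<comment> \<open>The single occurrence lies in one of \<open>t\<close> and \<open>s\<close>;
      the other does not change with the sample.\<close>
    proof (cases "occ y s = 0")
      case True
      then have "csub 0 (\<sigma>(y := x)) s = csub 0 \<sigma> s" for x
        using csub_upd_occ[of y 0 s \<sigma> x "\<sigma> y"] by simp
      then show ?thesis
        using cl[OF S_App.IH(1)] sound_good[OF S_App.IH(2) *(1)] *(3)
        by (auto intro: close_App_left[OF d])
    next
      case False
      then have "csub 0 (\<sigma>(y := x)) t = csub 0 \<sigma> t" for x
        using csub_upd_occ[of y 0 t \<sigma> x "\<sigma> y"] *(3) by simp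
      moreover have "good_term d A (csub 0 (\<sigma>(y := x)) s)" if "x \<in> set_spmf D \<union> set_spmf E" for x
        using upd[OF that] by (rule sound_good[OF S_App.IH(2)])
      ultimately show ?thesis
        using cl[OF S_App.IH(2)] sound_good[OF S_App.IH(1) *(1)] *(3-5)
        by (auto intro!: close_App_right[OF d] simp: good_dist_def)
    qed
  qed
next
  case (S_Case \<Gamma> t t0 A t1 te)
  show ?case
  proof (rule soundI[OF d])
    fix \<sigma>
    assume "good_sub d \<Gamma> \<sigma>"
    then show "good_term d A (csub 0 \<sigma> (Case A t t0 t1 te))"
      unfolding csub.simps
      by (intro good_term_str_bind[OF _ eval_Case, folded good_term_def] branch_cases[where P = "good_term d A"]
          S_Case.IH[THEN sound_good])
  next
    fix \<sigma> y b C D E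
    assume *: "good_sub d \<Gamma> \<sigma>" "\<Gamma> y = Some (b, C)" "occ y (Case A t t0 t1 te) = 1" "good_dist d C D" "good_dist d C E"
      "close d C (bind_spmf D eval) (bind_spmf E eval)"
    assume upd: "\<And>s. s \<in> set_spmf D \<union> set_spmf E \<Longrightarrow> good_sub d \<Gamma> (\<sigma>(y := s))"
      and cl: "\<And>u C. sound d \<Gamma> u C \<Longrightarrow> occ y u \<le> 1 \<Longrightarrow>
        close d C (bind_spmf D (\<lambda>s. eval (csub 0 (\<sigma>(y := s)) u))) (bind_spmf E (\<lambda>s. eval (csub 0 (\<sigma>(y := s)) u)))"
    show "close d A (bind_spmf D (\<lambda>x. eval (csub 0 (\<sigma>(y := x)) (Case A t t0 t1 te))))
        (bind_spmf E (\<lambda>x. eval (csub 0 (\<sigma>(y := x)) (Case A t t0 t1 te))))"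
    \<comment> \<open>An unchanged scrutinee leaves a mixture, over its outcomes, of one branch
      each; a changed one leaves fixed branches, hence a kernel on strings.\<close>
    proof (cases "occ y t = 0")
      case True
      then have t: "csub 0 (\<sigma>(y := x)) t = csub 0 \<sigma> t" for x
        using csub_upd_occ[of y 0 t \<sigma> x "\<sigma> y"] by simp
      have "close d A (bind_spmf D (\<lambda>x. eval (csub 0 (\<sigma>(y := x)) (branch m t0 t1 te))))
          (bind_spmf E (\<lambda>x. eval (csub 0 (\<sigma>(y := x)) (branch m t0 t1 te))))" for m
        by (rule branch_cases[where P = "\<lambda>u. close d A (bind_spmf D (\<lambda>x. eval (csub 0 (\<sigma>(y := x)) u)))
              (bind_spmf E (\<lambda>x. eval (csub 0 (\<sigma>(y := x)) u)))"])
           (use *(3) in \<open>auto intro!: cl S_Case.IH\<close>)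
      then show ?thesis
        unfolding csub.simps eval_Case t bind_str_bind_const branch_distrib[of "csub 0 _", symmetric]
        by (rule close_str_bind_right[OF d])
    next
      case False
      then have "csub 0 (\<sigma>(y := x)) t0 = csub 0 \<sigma> t0" "csub 0 (\<sigma>(y := x)) t1 = csub 0 \<sigma> t1"
        "csub 0 (\<sigma>(y := x)) te = csub 0 \<sigma> te" for x
        using csub_upd_occ[of y 0 _ \<sigma> x "\<sigma> y"] *(3) by simp_all
      then show ?thesis
        unfolding csub.simps eval_Case using *(3) sound_good[OF S_Case.IH(1) upd]
        by (auto intro!: close_scrutinee cl S_Case.IH)
    qed
  qed
next
  case (S_Rec \<Gamma> t t0 A t1 te)
  show ?case
  proof (rule soundI[OF d])
    fix \<sigma>
    assume \<sigma>: "good_sub d \<Gamma> \<sigma>"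
    show "good_term d A (csub 0 \<sigma> (Rec A t t0 t1 te))"
      unfolding csub.simps
      by (rule good_term_str_bind[OF sound_good[OF S_Rec.IH(1) \<sigma>] eval_Rec, folded good_term_def],
          rule good_term_Rec_Const[OF S_Rec.IH(2-4)[THEN sound_good, OF \<sigma>]])
  next
    fix \<sigma> y b C D E
    assume *: "good_sub d \<Gamma> \<sigma>" "\<Gamma> y = Some (b, C)" "occ y (Rec A t t0 t1 te) = 1" "good_dist d C D" "good_dist d C E"
      "close d C (bind_spmf D eval) (bind_spmf E eval)"
    assume upd: "\<And>s. s \<in> set_spmf D \<union> set_spmf E \<Longrightarrow> good_sub d \<Gamma> (\<sigma>(y := s))"
      and cl: "\<And>u C. sound d \<Gamma> u C \<Longrightarrow> occ y u \<le> 1 \<Longrightarrow>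
        close d C (bind_spmf D (\<lambda>s. eval (csub 0 (\<sigma>(y := s)) u))) (bind_spmf E (\<lambda>s. eval (csub 0 (\<sigma>(y := s)) u)))"
    \<comment> \<open>An occurrence in a step term would already count 2.\<close>
    have steps: "csub 0 (\<sigma>(y := x)) t0 = csub 0 \<sigma> t0" "csub 0 (\<sigma>(y := x)) t1 = csub 0 \<sigma> t1" for x
      using csub_upd_occ[of y 0 _ \<sigma> x "\<sigma> y"] *(3) by auto
    show "close d A (bind_spmf D (\<lambda>x. eval (csub 0 (\<sigma>(y := x)) (Rec A t t0 t1 te))))
        (bind_spmf E (\<lambda>x. eval (csub 0 (\<sigma>(y := x)) (Rec A t t0 t1 te))))"
    proof (cases "occ y t = 0")
      case True
      then have t: "csub 0 (\<sigma>(y := x)) t = csub 0 \<sigma> t" for x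
        using csub_upd_occ[of y 0 t \<sigma> x "\<sigma> y"] by simp
      have "good_term d A (csub 0 (\<sigma>(y := x)) te)" if "x \<in> set_spmf D \<union> set_spmf E" for x
        using upd[OF that] by (rule sound_good[OF S_Rec.IH(4)])
      then show ?thesis
        unfolding csub.simps eval_Rec[of _ "csub 0 _ t"] t steps bind_str_bind_const
        using *(3-5) sound_good[OF S_Rec.IH(2) *(1)] sound_good[OF S_Rec.IH(3) *(1)]
        by (intro close_str_bind_right[OF d] close_Rec_Const[OF d] cl S_Rec.IH) (auto simp: good_dist_def)
    next
      case False
      then have "csub 0 (\<sigma>(y := x)) te = csub 0 \<sigma> te" for x
        using csub_upd_occ[of y 0 te \<sigma> x "\<sigma> y"] *(3) by simp
      then show ?thesis
        unfolding csub.simps eval_Rec[of _ "csub 0 _ t"] steps using *(3) sound_good[OF S_Rec.IH(1) upd]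
        by (auto intro!: close_scrutinee cl S_Rec.IH)
    qed
  qed
qed

text \<open>The entries \<open>Const []\<close> are dummies that only have to be closed. Besides
  termination, this makes every value passed by a compatible trace good.\<close>

lemma closed_good_term:
  assumes "0 \<le> d" and "has_type Map.empty t A"
  shows "good_term d A t"
proof -
  have "good_sub d Map.empty (\<lambda>_. Const [])"
    by (simp add: good_sub_def)
  then have "good_term d A (csub 0 (\<lambda>_. Const []) t)"
    using sound_good[OF fundamental[OF assms(1) has_type_styping[OF assms(2)]]] by blast
  then show ?thesis
    using scoped_csub[OF closed_scoped[OF assms(2)]] by simp
qed

section \<open>Contexts as terms with a linear variable\<close>

fun inhab :: "ty \<Rightarrow> trm" where
  "inhab TStr = Const []"
| "inhab (Arr a A B) = Lam a A (inhab B)"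

lemma inhab_value: "is_value (inhab A)"
  by (cases A) auto

lemma inhab_typed: "has_type \<Gamma> (inhab A) A"
  by (induction A arbitrary: \<Gamma>) (auto intro: has_type.intros)

lemma Const_inv: "has_type \<Gamma> (Const m) B \<Longrightarrow> subtype TStr B"
  by (induction \<Gamma> "Const m" B rule: has_type.induct) (auto intro: subtype.intros)

lemma Lam_inv:
  "has_type \<Gamma> (Lam a A t) C \<Longrightarrow> \<exists>B. has_type (ext a A \<Gamma>) t B \<and> subtype (Arr a A B) C"
  by (induction \<Gamma> "Lam a A t" C rule: has_type.induct) (auto intro: subtype.intros)

lemma asp_le_refl: "asp_le a a"
  by (cases a) auto

text \<open>The annotations of the abstractions fix aspects and domains, so only subsumption can
  change the type.\<close>

lemma inhab_least_type: "has_type \<Gamma> (inhab A) B \<Longrightarrow> subtype A B"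
proof (induction A arbitrary: \<Gamma> B)
  case TStr
  then show ?case
    by (auto dest: Const_inv)
next
  case (Arr a A1 A2)
  then obtain C where "has_type (ext a A1 \<Gamma>) (inhab A2) C" "subtype (Arr a A1 C) B"
    by (auto dest: Lam_inv)
  then show ?case
    using Arr.IH(2) by (blast intro: subtype.intros asp_le_refl)
qed

fun plug :: "ctx \<Rightarrow> nat \<Rightarrow> trm" where
  "plug (CTerm t) y = t"
| "plug Hole y = Var y"
| "plug (CLam a A C) y = Lam a A (plug C (Suc y))"
| "plug (CAppL C t) y = App (plug C y) t"
| "plug (CAppR t C) y = App t (plug C y)"
| "plug (CZero C) y = Zero (plug C y)"
| "plug (COne C) y = One (plug C y)"
| "plug (CTail C) y = Tail (plug C y)"
| "plug (CCase A C t0 t1 te) y = Case A (plug C y) t0 t1 te"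
| "plug (CBranch A t C0 C1 Ce) y = Case A t (plug C0 y) (plug C1 y) (plug Ce y)"
| "plug (CRec A C t0 t1 te) y = Rec A (plug C y) t0 t1 te"

text \<open>Any filling \<open>u\<close> certifies that the rest of \<open>C\<close> has no variable
  from \<open>k\<close> on, so \<open>csub k\<close> acts on the hole alone.\<close>

lemma csub_plug: "scoped k (fill C u) \<Longrightarrow> csub k \<sigma> (plug C k) = fill C (\<sigma> 0)"
  by (induction C arbitrary: k) (auto simp: scoped_csub)

text \<open>Contexts have no hole in the step terms of a recursion, so no hole is counted
  twice.\<close>

lemma occ_plug: "scoped k (fill C u) \<Longrightarrow> occ k (plug C k) = holes C"
  by (induction C arbitrary: k) (auto simp: scoped_occ)

lemma plug_no_holes: "holes C = 0 \<Longrightarrow> plug C y = fill C u"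
  by (induction C arbitrary: y) auto

lemma upd_map_add:
  assumes "(f ++ g) y = None"
  shows "(f ++ g)(y \<mapsto> p) = f(y \<mapsto> p) ++ g"
  using assms by (auto simp: fun_eq_iff map_add_def split: option.splits)

lemma upd_weakening: "has_type \<Gamma> t B \<Longrightarrow> \<Gamma> y = None \<Longrightarrow> has_type (\<Gamma>(y \<mapsto> p)) t B"
  by (erule weakening) (auto simp: map_le_iff)

lemma ctx_le_upd_Box: "ctx_le \<Gamma> b \<Longrightarrow> ctx_le (\<Gamma>(y \<mapsto> (Box, A))) b"
  by (auto simp: ctx_le_def)

text \<open>Excludes \<open>C = Hole\<close> in the typing rules whose subject is not a
  value.\<close>

lemma inhab_not [simp]:
  "Var x \<noteq> inhab A" "Zero t \<noteq> inhab A" "One t \<noteq> inhab A" "Tail t \<noteq> inhab A" "App t s \<noteq> inhab A"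
  "Case B t t0 t1 te \<noteq> inhab A" "Rec B t t0 t1 te \<noteq> inhab A" "Rand \<noteq> inhab A"
  by (cases A; simp)+

lemma plug_Hole_typing: "has_type \<Gamma> (inhab A) B \<Longrightarrow> has_type (\<Gamma>(y \<mapsto> (Box, A))) (plug Hole y) B"
  by (simp, rule has_type.T_Sub[OF has_type.T_Var[of _ y Box A] inhab_least_type]) simp_all

lemma plug_no_holes_typing:
  "has_type \<Gamma> (fill C (inhab A)) B \<Longrightarrow> \<Gamma> y = None \<Longrightarrow> holes C = 0 \<Longrightarrow> has_type (\<Gamma>(y \<mapsto> p)) (plug C y) B"
  by (simp add: plug_no_holes[of C y "inhab A"] upd_weakening)

text \<open>As \<open>inhab A\<close> has least type \<open>A\<close>, a typing of \<open>C\<close> filled with it types \<open>C\<close> with a variable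
  of type \<open>A\<close> in the hole; the aspect \<^const>\<open>Box\<close> of this variable meets all side conditions.\<close>

lemma plug_typing:
  "has_type \<Gamma> (fill C (inhab A)) B \<Longrightarrow> \<Gamma> y = None \<Longrightarrow> holes C \<le> 1 \<Longrightarrow>
    has_type (\<Gamma>(y \<mapsto> (Box, A))) (plug C y) B"
proof (induction \<Gamma> "fill C (inhab A)" B arbitrary: C y rule: has_type.induct)
  case (T_Var \<Gamma> x a B)
  then show ?case
    using upd_weakening[OF has_type.T_Var[of \<Gamma> x a B]] by (cases C) auto
next
  case (T_Const \<Gamma> m)
  show ?case
  proof (cases C)
    case Hole
    then show ?thesis
      using has_type.T_Const[of \<Gamma> m] T_Const(1) plug_Hole_typing by (metis fill.simps(2))
  qed (use T_Const(1) in \<open>auto intro: has_type.T_Const\<close>)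
next
  case (T_Rand \<Gamma>)
  then show ?case
    by (cases C) (auto intro: has_type.T_Rand)
next
  case (T_Zero \<Gamma> t)
  then show ?case
    using upd_weakening by (cases C) (auto intro!: has_type.T_Zero)
next
  case (T_One \<Gamma> t)
  then show ?case
    using upd_weakening by (cases C) (auto intro!: has_type.T_One)
next
  case (T_Tail \<Gamma> t)
  then show ?case
    using upd_weakening by (cases C) (auto intro!: has_type.T_Tail)
next
  case (T_Lam a D \<Gamma> t B)
  have typed: "has_type \<Gamma> (Lam a D t) (Arr a D B)"
    using T_Lam.hyps(1) by (rule has_type.T_Lam)
  show ?case
  proof (cases C)
    case (CLam a' D' C')
    have "(ext a D \<Gamma>)(Suc y \<mapsto> p) = ext a D (\<Gamma>(y \<mapsto> p))" for p
      by (auto simp: fun_eq_iff ext_def split: nat.split)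
    then show ?thesis
      using CLam T_Lam.hyps(3) T_Lam.prems T_Lam.hyps(2)[of C' "Suc y"] by (auto intro: has_type.T_Lam)
  next
    case (CTerm t')
    then show ?thesis
      using typed T_Lam.hyps(3) T_Lam.prems upd_weakening by auto
  next
    case Hole
    then show ?thesis
      using typed T_Lam.hyps(3) plug_Hole_typing by (metis fill.simps(2))
  qed (use T_Lam.hyps(3) in auto)
next
  case (T_Sub \<Gamma> B B')
  then show ?case
    by (blast intro: has_type.T_Sub)
next
  case (T_App \<Gamma> \<Delta>1 \<Delta>2 t a D B s)
  note typed = has_type.T_App[OF T_App.hyps(1,2,3,5,7)]
  have none: "\<Gamma> y = None" "\<Delta>1 y = None" "\<Delta>2 y = None"
    using T_App.prems by auto
  show ?case
  proof (cases C)
    case (CTerm t')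
    then show ?thesis
      using upd_weakening[OF typed] T_App.hyps(8) T_App.prems by auto
  next
    case (CAppL C' s')
    \<comment> \<open>\<open>A\<close> need not be \<open>TStr\<close>, so the new declaration joins
      the unshared part of the premise containing the hole; likewise for case and recursion.\<close>
    have "has_type (\<Gamma> ++ \<Delta>1(y \<mapsto> (Box, A))) (plug C' y) (Arr a D B)"
      using T_App.hyps(4)[of C' y] T_App.hyps(8) T_App.prems none CAppL by auto
    then have "has_type (\<Gamma> ++ \<Delta>1(y \<mapsto> (Box, A)) ++ \<Delta>2) (App (plug C' y) s) B"
      using T_App.hyps none by (intro has_type.T_App) (auto simp: disjoint_ctxs_def)
    then show ?thesis
      using CAppL T_App.hyps(8) none by (simp add: upd_map_add)
  next
    case (CAppR s' C')
    have "has_type (\<Gamma> ++ \<Delta>2(y \<mapsto> (Box, A))) (plug C' y) D"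
      using T_App.hyps(6)[of C' y] T_App.hyps(8) T_App.prems none CAppR by auto
    then have "has_type (\<Gamma> ++ \<Delta>1 ++ \<Delta>2(y \<mapsto> (Box, A))) (App t (plug C' y)) B"
      using T_App.hyps none ctx_le_upd_Box[OF T_App.hyps(7)]
      by (intro has_type.T_App) (auto simp: disjoint_ctxs_def)
    then show ?thesis
      using CAppR T_App.hyps(8) by simp
  qed (use T_App.hyps(8) in auto)
next
  case (T_Case \<Gamma> \<Delta>1 \<Delta>2 \<Delta>3 \<Delta>4 t t0 B t1 te)
  note typed = has_type.T_Case[OF T_Case.hyps(1,2,3,5,7,9)]
  have none: "\<Gamma> y = None" "\<Delta>1 y = None" "\<Delta>2 y = None" "\<Delta>3 y = None" "\<Delta>4 y = None"
    using T_Case.prems by auto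
  show ?case
  proof (cases "holes C = 0")
    case True
    then show ?thesis
      using plug_no_holes_typing typed T_Case.hyps(11) T_Case.prems(1) by metis
  next
    case holes: False
    show ?thesis
    proof (cases C)
      case (CCase B' C' t0' t1' te')
      have "has_type (\<Gamma> ++ \<Delta>1(y \<mapsto> (Box, A))) (plug C' y) TStr"
        using T_Case.hyps(4)[of C' y] T_Case.hyps(11) T_Case.prems none CCase by auto
      then have "has_type (\<Gamma> ++ \<Delta>1(y \<mapsto> (Box, A)) ++ \<Delta>2 ++ \<Delta>3 ++ \<Delta>4) (Case B (plug C' y) t0 t1 te) B"
        using T_Case.hyps none by (intro has_type.T_Case) (auto simp: disjoint_ctxs_def)
      then show ?thesis
        using CCase T_Case.hyps(11) none by (simp add: upd_map_add)
    next
      case (CBranch B' t' C0 C1 Ce)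
      then have fills: "B' = B" "t' = t" "t0 = fill C0 (inhab A)" "t1 = fill C1 (inhab A)" "te = fill Ce (inhab A)"
        using T_Case.hyps(11) by auto
      \<comment> \<open>With a single hole, the other two branches are ordinary terms that
        \<open>plug\<close> leaves as they are.\<close>
      consider "holes C0 = 1" "holes C1 = 0" "holes Ce = 0" | "holes C0 = 0" "holes C1 = 1" "holes Ce = 0"
        | "holes C0 = 0" "holes C1 = 0" "holes Ce = 1"
        using holes T_Case.prems CBranch by (auto simp: le_Suc_eq)
      then show ?thesis
      proof cases
        case 1
        have "has_type (\<Gamma> ++ \<Delta>2(y \<mapsto> (Box, A))) (plug C0 y) B"
          using T_Case.hyps(6)[of C0 y] 1 fills none by auto
        then have "has_type (\<Gamma> ++ \<Delta>1 ++ \<Delta>2(y \<mapsto> (Box, A)) ++ \<Delta>3 ++ \<Delta>4) (Case B t (plug C0 y) t1 te) B"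
          using T_Case.hyps none by (intro has_type.T_Case) (auto simp: disjoint_ctxs_def)
        then show ?thesis
          using CBranch fills none plug_no_holes[OF 1(2), of y "inhab A"] plug_no_holes[OF 1(3), of y "inhab A"] by (simp add: upd_map_add)
      next
        case 2
        have "has_type (\<Gamma> ++ \<Delta>3(y \<mapsto> (Box, A))) (plug C1 y) B"
          using T_Case.hyps(8)[of C1 y] 2 fills none by auto
        then have "has_type (\<Gamma> ++ \<Delta>1 ++ \<Delta>2 ++ \<Delta>3(y \<mapsto> (Box, A)) ++ \<Delta>4) (Case B t t0 (plug C1 y) te) B"
          using T_Case.hyps none by (intro has_type.T_Case) (auto simp: disjoint_ctxs_def)
        then show ?thesis
          using CBranch fills none plug_no_holes[OF 2(1), of y "inhab A"] plug_no_holes[OF 2(3), of y "inhab A"] by (simp add: upd_map_add)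
      next
        case 3
        have "has_type (\<Gamma> ++ \<Delta>4(y \<mapsto> (Box, A))) (plug Ce y) B"
          using T_Case.hyps(10)[of Ce y] 3 fills none by auto
        then have "has_type (\<Gamma> ++ \<Delta>1 ++ \<Delta>2 ++ \<Delta>3 ++ \<Delta>4(y \<mapsto> (Box, A))) (Case B t t0 t1 (plug Ce y)) B"
          using T_Case.hyps none by (intro has_type.T_Case) (auto simp: disjoint_ctxs_def)
        then show ?thesis
          using CBranch fills none plug_no_holes[OF 3(1), of y "inhab A"] plug_no_holes[OF 3(2), of y "inhab A"] by simp
      qed
    qed (use T_Case.hyps(11) holes in auto)
  qed
next
  case (T_Rec \<Gamma>1 \<Gamma>2 \<Gamma>3 \<Delta>1 \<Delta>2 t t0 B t1 te)
  note typed = has_type.T_Rec[OF T_Rec.hyps(1,2,3,5,7,9,11,12)]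
  have none: "\<Gamma>1 y = None" "\<Gamma>2 y = None" "\<Gamma>3 y = None" "\<Delta>1 y = None" "\<Delta>2 y = None"
    using T_Rec.prems by auto
  show ?case
  proof (cases C)
    case (CTerm t')
    then show ?thesis
      using upd_weakening[OF typed] T_Rec.hyps(13) T_Rec.prems by auto
  next
    case (CRec B' C' t0' t1' te')
    have "has_type (\<Gamma>1 ++ \<Delta>1(y \<mapsto> (Box, A))) (plug C' y) TStr"
      using T_Rec.hyps(4)[of C' y] T_Rec.hyps(13) T_Rec.prems none CRec by auto
    then have "has_type (\<Gamma>1 ++ \<Gamma>2 ++ \<Gamma>3 ++ \<Delta>1(y \<mapsto> (Box, A)) ++ \<Delta>2) (Rec B (plug C' y) t0 t1 te) B"
      using T_Rec.hyps none ctx_le_upd_Box[OF T_Rec.hyps(11)]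
      by (intro has_type.T_Rec) (auto simp: disjoint_ctxs_def)
    then show ?thesis
      using CRec T_Rec.hyps(13) none by (simp add: upd_map_add)
  qed (use T_Rec.hyps(13) in auto)
qed


section \<open>Traces\<close>

lemma run_bounds: "compatible A S \<Longrightarrow> 0 \<le> run D S \<and> run D S \<le> 1"
  by (induction arbitrary: D rule: compatible.induct) (simp_all add: sum_spmf_outcome outcome_bounds)

lemma ex_compatible: "\<exists>S. compatible A S"
proof (induction A)
  case TStr
  then show ?case
    by (blast intro: compatible.intros(1)[of "{}"])
next
  case (Arr a A B)
  then show ?case
    using inhab_value inhab_typed by (blast intro: compatible.intros(2))
qed

lemma bdd_above_trace_diff:
  "bdd_above ((\<lambda>S. \<bar>trace_prob \<T> S - trace_prob \<S> S\<bar>) ` {S. compatible A S})"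
proof (rule bdd_aboveI2)
  show "\<bar>trace_prob \<T> S - trace_prob \<S> S\<bar> \<le> 1" if "S \<in> {S. compatible A S}" for S
    using that run_bounds[of A S "bind_pmf \<T> eval"] run_bounds[of A S "bind_pmf \<S> eval"]
    by (auto simp: trace_prob_def abs_le_iff)
qed

text \<open>A compatible trace passes values known only to be typed; \<open>closed_good_term\<close>
  makes them good.\<close>

lemma run_diff_le_if_close:
  "compatible A S \<Longrightarrow> 0 \<le> d \<Longrightarrow> close d A D E \<Longrightarrow> \<bar>run D S - run E S\<bar> \<le> d"
proof (induction arbitrary: D E rule: compatible.induct)
  case (2 v B C S b)
  then have "good d B v"
    by (intro good_term_value closed_good_term)
  then show ?case
    using 2 by simp
qed (simp add: sum_spmf_outcome)

text \<open>Conversely, good values are typed values, so the tests of \<open>close\<close> are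
  compatible traces.\<close>

lemma close_if_run_diff_le:
  "(\<And>S. compatible A S \<Longrightarrow> \<bar>run D S - run E S\<bar> \<le> d) \<Longrightarrow> close d A D E"
proof (induction A arbitrary: D E)
  case TStr
  then show ?case
    using compatible.intros(1) by (fastforce simp: sum_spmf_outcome[symmetric])
next
  case (Arr a A B)
  have "close d B (pass u D) (pass u E)" if "good d A u" for u
    using Arr.prems[OF compatible.intros(2)] good_typed[OF that] by (intro Arr.IH(2)) auto
  then show ?case
    by simp
qed

theorem mainTheorem7:
  fixes A B :: ty and \<T> \<S> :: "trm pmf" and d :: real and C :: ctx
  assumes "term_dist A \<T>" and "term_dist A \<S>"
    and "trace_distance A \<T> \<S> = d"
    and "holes C \<le> 1"
    and "ctx_typed C A B"
  shows "trace_distance B (fill_dist C \<T>) (fill_dist C \<S>) \<le> d"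
proof -
  have diff: "\<bar>trace_prob \<T> S - trace_prob \<S> S\<bar> \<le> d" if "compatible A S" for S
    unfolding assms(3)[symmetric] trace_distance_def using that
    by (intro cSUP_upper bdd_above_trace_diff) simp
  obtain S\<^sub>0 where "compatible A S\<^sub>0"
    using ex_compatible by blast
  \<comment> \<open>A bound on absolute values is nonnegative once a single trace exists.\<close>
  with diff have d: "0 \<le> d"
    using abs_ge_zero order_trans by blast
  let ?D = "spmf_of_pmf \<T>" and ?E = "spmf_of_pmf \<S>"
  let ?\<Gamma> = "Map.empty(0 \<mapsto> (Box, A))"
  \<comment> \<open>This one instance of \<open>ctx_typed\<close> is turned into a derivation for
    the open term \<open>plug C 0\<close>.\<close>
  have filled: "has_type Map.empty (fill C (inhab A)) B"
    using assms(5) inhab_typed by (simp add: ctx_typed_def)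
  then have scoped: "scoped 0 (fill C (inhab A))"
    by (rule closed_scoped)
  have plug: "sound d ?\<Gamma> (plug C 0) B"
    using plug_typing[OF filled] assms(4) by (intro fundamental[OF d] has_type_styping) simp
  \<comment> \<open>Entry 0 is overwritten by the samples; \<open>inhab A\<close> only supplies a
    good term of the declared type.\<close>
  have good_sub: "good_sub d ?\<Gamma> (\<lambda>_. inhab A)"
    using inhab_typed[of Map.empty A] closed_good_term[OF d] closed_scoped
    by (auto simp: good_sub_def split: if_splits)
  have dist: "good_dist d A ?D" "good_dist d A ?E"
    using assms(1,2) closed_good_term[OF d] by (auto simp: good_dist_def term_dist_def)
  have "close d A (bind_spmf ?D eval) (bind_spmf ?E eval)"
    using diff by (intro close_if_run_diff_le) (simp add: trace_prob_def)
  then have "close d B (bind_spmf ?D (\<lambda>s. eval (csub 0 ((\<lambda>_. inhab A)(0 := s)) (plug C 0))))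
      (bind_spmf ?E (\<lambda>s. eval (csub 0 ((\<lambda>_. inhab A)(0 := s)) (plug C 0))))"
    using plug good_sub dist occ_plug[OF scoped] assms(4)
    by (intro linear_nonexpansiveD[where \<Gamma> = ?\<Gamma> and y = 0 and a = Box and A = A]) (auto simp: sound_def)
  then have "close d B (bind_pmf \<T> (\<lambda>s. eval (fill C s))) (bind_pmf \<S> (\<lambda>s. eval (fill C s)))"
    by (simp add: csub_plug[OF scoped])
  then have "\<bar>trace_prob (fill_dist C \<T>) S - trace_prob (fill_dist C \<S>) S\<bar> \<le> d" if "compatible B S" for S
    using run_diff_le_if_close[OF that d] by (simp add: trace_prob_def fill_dist_def bind_map_pmf)
  then show ?thesis
    unfolding trace_distance_def using ex_compatible by (intro cSUP_least) auto
qed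

end
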